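(* Let $(W,S)$ be a Coxeter system, $I,J\subseteq S$, and $w\in{}^IW^J$. Then $C=W_IwW_J$ is a lex-minimal presentation if and only if (a) no connected component of $J$ is contained in $(w^{-1}Iw)\cap S$, and (b) if a connected component $I_0$ of $I$ is contained in $wSw^{-1}$, then $w^{-1}I_0w$ is not contained in $J$, and there is an element of $J$ adjacent to or contained in $w^{-1}I_0w$. Furthermore, every parabolic double coset has a unique lex-minimal presentation.
   Context: $(W,S)$ is a Coxeter system with $S$ finite and Coxeter graph on vertex set $S$ (edge $\{s,t\}$ iff $st$ has order $>2$); connected components and adjacency refer to this graph. $W_I$ is the subgroup generated by $I$; ${}^IW^J=\{x: \ell(sx)>\ell(x)\ \forall s\in I,\ \ell(xs)>\ell(x)\ \forall s\in J\}$. A presentation of a parabolic double coset $C$ is a triple $(I,x,J)$ with $C=W_IxW_J$; it is lex-minimal if $x$ is the Bruhat-minimal element of $C$ and $(|I|,|J|)$ is lexicographically minimal among all presentations of $C$. *)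

theory Defs
  imports "HOL-Algebra.Algebra"
begin

definition word_prod :: "('a, 'b) monoid_scheme \<Rightarrow> 'a list \<Rightarrow> 'a" where
  "word_prod W ws = foldr (\<lambda>a b. a \<otimes>\<^bsub>W\<^esub> b) ws \<one>\<^bsub>W\<^esub>"

text \<open>
  Insertion of a Coxeter relator \<open>(s t)^m(s,t)\<close>, where \<open>m(s,t)\<close> is the order of \<open>s t\<close> in the
  group. Since \<open>group.ord\<close> is 0 for elements of infinite order, such a pair contributes only the
  empty relator, that is, no relation. For \<open>s = t\<close> the relator is \<open>s s\<close>.
\<close>
definition relator_insertion :: "('a, 'b) monoid_scheme \<Rightarrow> 'a set \<Rightarrow> 'a list \<Rightarrow> 'a list \<Rightarrow> bool" where
  "relator_insertion W S u v \<longleftrightarrow>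
     (\<exists>a \<in> lists S. \<exists>b \<in> lists S. \<exists>s \<in> S. \<exists>t \<in> S.
        u = a @ b \<and>
        v = a @ concat (replicate (group.ord W (s \<otimes>\<^bsub>W\<^esub> t)) [s, t]) @ b)"

text \<open>
  \<open>W\<close> is the group with generators \<open>S\<close>, a set of involutions, and defining relations
  \<open>(s t)^m(s,t) = 1\<close> for \<open>m(s,t)\<close> finite. As each \<open>s s\<close> is a relator, formal inverses of generators
  are superfluous, and the presented group is the free monoid on \<open>S\<close> modulo insertion and deletion
  of relators; the last clause says that this quotient maps injectively to \<open>W\<close>.
\<close>
definition coxeter_system :: "('a, 'b) monoid_scheme \<Rightarrow> 'a set \<Rightarrow> bool" where
  "coxeter_system W S \<longleftrightarrow>
     group W \<and> S \<subseteq> carrier W \<and> generate W S = carrier W \<and>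
     (\<forall>s \<in> S. group.ord W s = 2) \<and>
     (\<forall>u \<in> lists S. \<forall>v \<in> lists S.
        word_prod W u = word_prod W v \<longleftrightarrow> equivclp (relator_insertion W S) u v)"

text \<open>Edges of the Coxeter graph: \<open>s t\<close> has order greater than 2, possibly infinite (order 0).\<close>
definition coxeter_adj :: "('a, 'b) monoid_scheme \<Rightarrow> 'a \<Rightarrow> 'a \<Rightarrow> bool" where
  "coxeter_adj W s t \<longleftrightarrow>
     group.ord W (s \<otimes>\<^bsub>W\<^esub> t) = 0 \<or> group.ord W (s \<otimes>\<^bsub>W\<^esub> t) > 2"

text \<open>Vertex sets of the connected components of the subgraph induced on \<open>J\<close>.\<close>
definition coxeter_components :: "('a, 'b) monoid_scheme \<Rightarrow> 'a set \<Rightarrow> 'a set set" where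
  "coxeter_components W J =
     J // {(s, t). s \<in> J \<and> t \<in> J \<and> (s, t) \<in> {(a, b). a \<in> J \<and> b \<in> J \<and> coxeter_adj W a b}\<^sup>*}"

definition cox_length :: "('a, 'b) monoid_scheme \<Rightarrow> 'a set \<Rightarrow> 'a \<Rightarrow> nat" where
  "cox_length W S w = (LEAST n. \<exists>ws \<in> lists S. length ws = n \<and> word_prod W ws = w)"

definition reflections :: "('a, 'b) monoid_scheme \<Rightarrow> 'a set \<Rightarrow> 'a set" where
  "reflections W S = {g \<otimes>\<^bsub>W\<^esub> s \<otimes>\<^bsub>W\<^esub> inv\<^bsub>W\<^esub> g | g s. g \<in> carrier W \<and> s \<in> S}"

definition bruhat_step :: "('a, 'b) monoid_scheme \<Rightarrow> 'a set \<Rightarrow> 'a \<Rightarrow> 'a \<Rightarrow> bool" where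
  "bruhat_step W S u v \<longleftrightarrow>
     u \<in> carrier W \<and> (\<exists>t \<in> reflections W S. v = u \<otimes>\<^bsub>W\<^esub> t) \<and> cox_length W S u < cox_length W S v"

definition bruhat_le :: "('a, 'b) monoid_scheme \<Rightarrow> 'a set \<Rightarrow> 'a \<Rightarrow> 'a \<Rightarrow> bool" where
  "bruhat_le W S = (bruhat_step W S)\<^sup>*\<^sup>*"

text \<open>The set usually written with \<open>I\<close> and \<open>J\<close> as left and right superscripts of \<open>W\<close>.\<close>
definition min_double_reps ::
    "('a, 'b) monoid_scheme \<Rightarrow> 'a set \<Rightarrow> 'a set \<Rightarrow> 'a set \<Rightarrow> 'a set" where
  "min_double_reps W S I J =
     {x \<in> carrier W. (\<forall>s \<in> I. cox_length W S (s \<otimes>\<^bsub>W\<^esub> x) > cox_length W S x) \<and>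
                     (\<forall>s \<in> J. cox_length W S (x \<otimes>\<^bsub>W\<^esub> s) > cox_length W S x)}"

definition double_coset :: "('a, 'b) monoid_scheme \<Rightarrow> 'a set \<Rightarrow> 'a \<Rightarrow> 'a set \<Rightarrow> 'a set" where
  "double_coset W I x J = (generate W I #>\<^bsub>W\<^esub> x) <#>\<^bsub>W\<^esub> generate W J"

definition presentation ::
    "('a, 'b) monoid_scheme \<Rightarrow> 'a set \<Rightarrow> 'a set \<Rightarrow> 'a set \<times> 'a \<times> 'a set \<Rightarrow> bool" where
  "presentation W S C = (\<lambda>(I, x, J).
     I \<subseteq> S \<and> x \<in> carrier W \<and> J \<subseteq> S \<and> C = double_coset W I x J)"

definition parabolic_double_coset :: "('a, 'b) monoid_scheme \<Rightarrow> 'a set \<Rightarrow> 'a set \<Rightarrow> bool" where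
  "parabolic_double_coset W S C \<longleftrightarrow> (\<exists>p. presentation W S C p)"

definition bruhat_minimum :: "('a, 'b) monoid_scheme \<Rightarrow> 'a set \<Rightarrow> 'a set \<Rightarrow> 'a \<Rightarrow> bool" where
  "bruhat_minimum W S C x \<longleftrightarrow> x \<in> C \<and> (\<forall>y \<in> C. bruhat_le W S x y)"

text \<open>
  The competing presentations \<open>(I', x', J')\<close> may use any representative \<open>x'\<close> of \<open>C\<close>. The
  cardinalities are meaningful only for finite \<open>S\<close>.
\<close>
definition lex_minimal_presentation ::
    "('a, 'b) monoid_scheme \<Rightarrow> 'a set \<Rightarrow> 'a set \<Rightarrow> 'a set \<times> 'a \<times> 'a set \<Rightarrow> bool" where
  "lex_minimal_presentation W S C = (\<lambda>(I, x, J).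
     presentation W S C (I, x, J) \<and> bruhat_minimum W S C x \<and>
     (\<forall>I' x' J'. presentation W S C (I', x', J') \<longrightarrow>
        card I < card I' \<or> card I = card I' \<and> card J \<le> card J'))"

end

theory Submission
  imports Defs "HOL-Library.Sublist"
begin

text \<open>
  Let \<open>w\<close> be the shortest element of \<open>C\<close>, and let \<open>L\<close>, \<open>R\<close> be the sets of simple reflections that
  stabilize \<open>C\<close> from the left and from the right. Every presentation of \<open>C\<close> yields one of the form
  \<open>(I, w, J)\<close> with \<open>I \<subseteq> L\<close> and \<open>J \<subseteq> R\<close>. The crucial point is rigidity: a component of \<open>L\<close> that is
  not contained in \<open>I\<close> lies entirely in \<open>w J w\<^sup>-\<^sup>1\<close>, and symmetrically for \<open>R\<close>. Hence \<open>I\<close> must contain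
  the components of \<open>L\<close> that \<open>w\<close> does not conjugate into \<open>R\<close>, and these alone suffice as \<open>I\<close>. For this
  smallest \<open>I\<close>, likewise, the least possible \<open>J\<close> consists of the components of \<open>R\<close> not contained
  in \<open>w\<^sup>-\<^sup>1 I w\<close>. This is the unique lex-minimal presentation, and conditions (a) and (b)
  characterize it by comparing the components of \<open>I\<close> and \<open>J\<close> with those of \<open>L\<close> and \<open>R\<close>.

  The exchange condition comes from the reflections \<open>s\<^sub>1 \<dots> s\<^sub>i \<dots> s\<^sub>1\<close> attached to the prefixes of
  a word: a relator contributes some list of reflections twice, so the parity with which
  a reflection occurs depends only on the group element.
\<close>

section \<open>Words, generated subgroups and length\<close>

locale coxeter = group W for W :: "('a, 'b) monoid_scheme" (structure) +
  fixes S :: "'a set"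
  assumes coxeter: "coxeter_system W S"
begin

abbreviation wp :: "'a list \<Rightarrow> 'a" where "wp \<equiv> word_prod W"
abbreviation len :: "'a \<Rightarrow> nat" where "len \<equiv> cox_length W S"

lemma coxeter_systemD:
  shows "S \<subseteq> carrier W" "generate W S = carrier W" "s \<in> S \<Longrightarrow> ord s = 2"
    "set u \<subseteq> S \<Longrightarrow> set v \<subseteq> S \<Longrightarrow> wp u = wp v \<longleftrightarrow> equivclp (relator_insertion W S) u v"
  using coxeter unfolding coxeter_system_def lists_eq_set by blast+

lemma gen_closed [simp, intro]: "s \<in> S \<Longrightarrow> s \<in> carrier W"
  using coxeter_systemD(1) by blast

lemma gen_square [simp]: "s \<in> S \<Longrightarrow> s \<otimes> s = \<one>"
  using pow_ord_eq_1[of s] by (simp add: coxeter_systemD(3) numeral_2_eq_2)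

lemma gen_neq_one: "s \<in> S \<Longrightarrow> s \<noteq> \<one>"
  using coxeter_systemD(3)[of s] by auto

lemma inv_gen [simp]: "s \<in> S \<Longrightarrow> inv s = s"
  by (simp add: inv_equality)

lemma cancel_simps [simp]:
  "x \<in> carrier W \<Longrightarrow> y \<in> carrier W \<Longrightarrow> inv x \<otimes> (x \<otimes> y) = y"
  "x \<in> carrier W \<Longrightarrow> y \<in> carrier W \<Longrightarrow> x \<otimes> (inv x \<otimes> y) = y"
  "s \<in> S \<Longrightarrow> y \<in> carrier W \<Longrightarrow> s \<otimes> (s \<otimes> y) = y"
  by (simp_all flip: m_assoc)

lemmas group_simps = m_assoc inv_mult_group

lemma wp_simps [simp]: "wp [] = \<one>" "wp (s # u) = s \<otimes> wp u"
  by (simp_all add: word_prod_def)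

lemma wp_closed [simp]: "set u \<subseteq> S \<Longrightarrow> wp u \<in> carrier W"
  by (induction u) auto

lemma wp_append [simp]: "set u \<subseteq> S \<Longrightarrow> set v \<subseteq> S \<Longrightarrow> wp (u @ v) = wp u \<otimes> wp v"
  by (induction u) (auto simp: m_assoc)

lemma wp_rev: "set u \<subseteq> S \<Longrightarrow> wp (rev u) = inv (wp u)"
  by (induction u) (auto simp: inv_mult_group)

lemma generate_closed [simp]: "K \<subseteq> S \<Longrightarrow> x \<in> generate W K \<Longrightarrow> x \<in> carrier W"
  using generate_in_carrier[of K x] by blast

lemma generate_iff:
  assumes "K \<subseteq> S"
  shows "x \<in> generate W K \<longleftrightarrow> (\<exists>u. set u \<subseteq> K \<and> wp u = x)"
proof
  assume "x \<in> generate W K"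
  then show "\<exists>u. set u \<subseteq> K \<and> wp u = x"
  proof induction
    case one
    then show ?case by (intro exI[of _ "[]"]) auto
  next
    case (incl h)
    then show ?case using assms by (intro exI[of _ "[h]"]) auto
  next
    case (inv h)
    then show ?case using assms by (intro exI[of _ "[h]"]) auto
  next
    case (eng h1 h2)
    then obtain u v where "set u \<subseteq> K" "wp u = h1" "set v \<subseteq> K" "wp v = h2" by auto
    moreover have "set u \<subseteq> S" "set v \<subseteq> S" using calculation assms by auto
    ultimately show ?case by (intro exI[of _ "u @ v"]) auto
  qed
next
  assume "\<exists>u. set u \<subseteq> K \<and> wp u = x"
  then obtain u where "set u \<subseteq> K" "wp u = x" by auto
  then show "x \<in> generate W K"
    by (induction u arbitrary: x) (auto intro: generate.intros)
qed

lemma carrier_word: "x \<in> carrier W \<Longrightarrow> \<exists>u. set u \<subseteq> S \<and> wp u = x"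
  using generate_iff[of S] coxeter_systemD(2) by simp

lemma len_le: "set u \<subseteq> S \<Longrightarrow> len (wp u) \<le> length u"
  unfolding cox_length_def by (rule Least_le) (auto simp: lists_eq_set)

lemma reduced_word:
  assumes "x \<in> carrier W"
  obtains u where "set u \<subseteq> S" "length u = len x" "wp u = x"
proof -
  have "\<exists>n. \<exists>u \<in> lists S. length u = n \<and> wp u = x"
    using carrier_word[OF assms] by (auto simp: lists_eq_set)
  then have "\<exists>u \<in> lists S. length u = len x \<and> wp u = x"
    unfolding cox_length_def by (rule LeastI_ex)
  then show ?thesis using that by (auto simp: lists_eq_set)
qed

lemma len_one [simp]: "len \<one> = 0"
  using len_le[of "[]"] by simp

lemma len_eq_0: "x \<in> carrier W \<Longrightarrow> len x = 0 \<longleftrightarrow> x = \<one>"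
  by (metis len_one length_0_conv reduced_word wp_simps(1))

lemma len_mult_le:
  assumes "x \<in> carrier W" "y \<in> carrier W"
  shows "len (x \<otimes> y) \<le> len x + len y"
proof -
  obtain u v where "set u \<subseteq> S" "length u = len x" "wp u = x" "set v \<subseteq> S" "length v = len y" "wp v = y"
    using assms reduced_word by metis
  then show ?thesis using len_le[of "u @ v"] by simp
qed

lemma len_gen [simp]: "s \<in> S \<Longrightarrow> len s = 1"
  using len_le[of "[s]"] len_eq_0[of s] gen_neq_one[of s] by (simp add: le_Suc_eq)

lemma len_eq_1:
  assumes "x \<in> carrier W" "len x = 1"
  shows "x \<in> S"
proof -
  obtain u where "set u \<subseteq> S" "length u = len x" "wp u = x"
    using assms reduced_word by metis
  then show ?thesis using assms by (cases u) auto
qed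

lemma len_inv:
  assumes "x \<in> carrier W"
  shows "len (inv x) = len x"
proof -
  have "len (inv y) \<le> len y" if y: "y \<in> carrier W" for y
  proof -
    obtain u where "set u \<subseteq> S" "length u = len y" "wp u = y"
      using reduced_word[OF y] by metis
    then show ?thesis using len_le[of "rev u"] by (auto simp: wp_rev)
  qed
  from this[of x] this[of "inv x"] assms show ?thesis by simp
qed

section \<open>The exchange condition\<close>

text \<open>For a word \<open>s1 ... sk\<close> the entry at position i is the product
  \<open>s1 ... si ... s1\<close>. Left multiplication of \<open>wp u\<close> by this entry deletes
  the letter \<open>si\<close>, which is what links reflections to exchange.\<close>

fun refl_seq :: "'a list \<Rightarrow> 'a list" where
  "refl_seq [] = []"
| "refl_seq (s # u) = s # map (\<lambda>t. s \<otimes> t \<otimes> s) (refl_seq u)"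

lemma refl_seq_closed: "set u \<subseteq> S \<Longrightarrow> set (refl_seq u) \<subseteq> carrier W"
  by (induction u) auto

lemma refl_seq_append:
  assumes "set u \<subseteq> S" "set v \<subseteq> S"
  shows "refl_seq (u @ v) = refl_seq u @ map (\<lambda>t. wp u \<otimes> t \<otimes> inv (wp u)) (refl_seq v)"
  using assms
proof (induction u)
  case Nil
  then show ?case using refl_seq_closed[of v] by (auto intro!: map_idI[symmetric])
next
  case (Cons s u)
  then show ?case using refl_seq_closed[of v] by (auto simp: group_simps)
qed

text \<open>Prefixing the two letters \<open>s\<close>, \<open>t\<close> conjugates all earlier
  entries by \<open>s \<otimes> t\<close>. Since conjugation by \<open>s\<close> inverts
  \<open>s \<otimes> t\<close>, this raises the exponent in
  \<open>(s \<otimes> t) [^] i \<otimes> s\<close> by 2.\<close>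

lemma refl_seq_dihedral:
  assumes "s \<in> S" "t \<in> S"
  shows "refl_seq (concat (replicate k [s, t])) = map (\<lambda>i. (s \<otimes> t) [^] i \<otimes> s) [0..<2 * k]"
proof (induction k)
  case 0
  then show ?case by simp
next
  case (Suc k)
  have "set (concat (replicate k [s, t])) \<subseteq> S" using assms by (induction k) auto
  then have "refl_seq (concat (replicate (Suc k) [s, t])) =
      [s, s \<otimes> t \<otimes> s] @ map (\<lambda>r. s \<otimes> t \<otimes> r \<otimes> inv (s \<otimes> t)) (refl_seq (concat (replicate k [s, t])))"
    using refl_seq_append[of "[s, t]" "concat (replicate k [s, t])"] assms by simp
  also have "\<dots> = [s, s \<otimes> t \<otimes> s] @ map (\<lambda>i. (s \<otimes> t) [^] (i + 2) \<otimes> s) [0..<2 * k]"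
  proof -
    have "s \<otimes> t \<otimes> ((s \<otimes> t) [^] i \<otimes> s) \<otimes> inv (s \<otimes> t) = (s \<otimes> t) [^] (i + 2) \<otimes> s" for i :: nat
    proof -
      have "(s \<otimes> t) [^] (i + 2) = (s \<otimes> t) \<otimes> ((s \<otimes> t) [^] i \<otimes> (s \<otimes> t))"
        using assms by (metis add_2_eq_Suc' gen_closed m_closed nat_pow_Suc nat_pow_Suc2)
      then show ?thesis using assms by (simp add: group_simps)
    qed
    then show ?thesis by (simp add: Suc.IH)
  qed
  also have "\<dots> = map (\<lambda>i. (s \<otimes> t) [^] i \<otimes> s) ([0, 1] @ map (\<lambda>i. i + 2) [0..<2 * k])"
    using assms by simp
  also have "[0, 1] @ map (\<lambda>i. i + 2) [0..<2 * k] = [0..<2 * Suc k]"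
    using map_add_upt[of 2 "2 * k"] upt_conv_Cons[of 0 "2 * k + 2"] upt_conv_Cons[of 1 "2 * k + 2"]
    by (simp add: numeral_2_eq_2)
  finally show ?case .
qed

text \<open>If m is the order of \<open>s \<otimes> t\<close>, the exponents run from 0 to 2m - 1
  and matter only modulo m. For infinite order m is 0 and the list is empty.\<close>

lemma refl_seq_relator_double:
  assumes "s \<in> S" "t \<in> S"
  shows "\<exists>xs. refl_seq (concat (replicate (ord (s \<otimes> t)) [s, t])) = xs @ xs"
proof -
  let ?m = "ord (s \<otimes> t)"
  let ?f = "\<lambda>i. (s \<otimes> t) [^] i \<otimes> s"
  have "?f (i + ?m) = ?f i" for i
    using assms by (simp add: nat_pow_mult[symmetric])
  then have "map ?f (map (\<lambda>i. i + ?m) [0..<?m]) = map ?f [0..<?m]"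
    by simp
  moreover have "[0..<2 * ?m] = [0..<?m] @ map (\<lambda>i. i + ?m) [0..<?m]"
    using upt_add_eq_append[of 0 ?m ?m] by (simp add: map_add_upt mult_2)
  ultimately show ?thesis unfolding refl_seq_dihedral[OF assms] by (metis map_append)
qed

text \<open>The relator has product one, so the reflections contributed by the suffix
  \<open>b\<close> stay the same. The relator itself adds a doubled list, conjugated by
  \<open>wp a\<close>.\<close>

lemma relator_insertion_parity:
  assumes "relator_insertion W S u v"
  shows "odd (count_list (refl_seq u) t) \<longleftrightarrow> odd (count_list (refl_seq v) t)"
proof -
  obtain a b p q where ab: "set a \<subseteq> S" "set b \<subseteq> S" "p \<in> S" "q \<in> S" and u: "u = a @ b"
    and v: "v = a @ concat (replicate (ord (p \<otimes> q)) [p, q]) @ b"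
    using assms by (auto simp: relator_insertion_def lists_eq_set)
  define r where "r = concat (replicate (ord (p \<otimes> q)) [p, q])"
  have r: "set r \<subseteq> S" unfolding r_def using ab by (auto split: if_splits)
  have "wp (concat (replicate k [p, q])) = (p \<otimes> q) [^] k" for k
  proof (induction k)
    case (Suc k)
    then show ?case
      using ab nat_pow_Suc2[of "p \<otimes> q" k] by (simp add: m_assoc)
  qed simp
  then have "wp r = \<one>" unfolding r_def using ab by simp
  then have "refl_seq (r @ b) = refl_seq r @ refl_seq b"
    using refl_seq_append[OF r ab(2)] refl_seq_closed[OF ab(2)] by (auto intro!: map_idI)
  moreover obtain xs where "refl_seq r = xs @ xs"
    using refl_seq_relator_double[OF ab(3,4)] r_def by auto
  ultimately show ?thesis
    unfolding u v r_def[symmetric] using ab r by (auto simp: refl_seq_append)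
qed

text \<open>Here the defining relations enter: words with equal product are linked by insertions and
  deletions of relators, and each of these preserves parity.\<close>

lemma refl_seq_parity:
  assumes "set u \<subseteq> S" "set v \<subseteq> S" "wp u = wp v"
  shows "odd (count_list (refl_seq u) t) \<longleftrightarrow> odd (count_list (refl_seq v) t)"
proof -
  have "equivclp (relator_insertion W S) u v"
    using assms coxeter_systemD(4) by blast
  then show ?thesis
    by (induction rule: equivclp_induct) (use relator_insertion_parity in blast)+
qed

text \<open>If \<open>t\<close> is the head \<open>s\<close>, it cancels the first letter. Otherwise
  \<open>t = s \<otimes> t' \<otimes> s\<close>, and \<open>t'\<close> deletes a letter of the tail
  by induction.\<close>

lemma refl_seq_delete:
  assumes "set u \<subseteq> S" "t \<in> set (refl_seq u)"
  shows "\<exists>a s b. u = a @ s # b \<and> t \<otimes> wp u = wp (a @ b)"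
  using assms
proof (induction u arbitrary: t)
  case Nil
  then show ?case by simp
next
  case (Cons s u)
  show ?case
  proof (cases "t = s")
    case True
    then show ?thesis using Cons.prems by (intro exI[of _ "[]"]) auto
  next
    case False
    then obtain t' where t': "t' \<in> set (refl_seq u)" "t = s \<otimes> t' \<otimes> s" using Cons.prems by auto
    moreover have "t' \<in> carrier W" using refl_seq_closed[of u] t' Cons.prems by auto
    moreover obtain a r b where "u = a @ r # b" "t' \<otimes> wp u = wp (a @ b)"
      using Cons.IH[OF _ t'(1)] Cons.prems(1) by auto
    ultimately have "s # u = (s # a) @ r # b" "t \<otimes> wp (s # u) = wp ((s # a) @ b)"
      using Cons.prems(1) by (simp_all add: m_assoc)
    then show ?thesis by blast
  qed
qed

text \<open>Conjugation by \<open>s\<close> sends nothing but \<open>s\<close> to \<open>s\<close>,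
  so the new head is the only change in the count.\<close>

lemma refl_seq_Cons_parity:
  assumes "s \<in> S" "set u \<subseteq> S"
  shows "odd (count_list (refl_seq (s # u)) s) \<longleftrightarrow> even (count_list (refl_seq u) s)"
proof -
  have "s \<otimes> t \<otimes> s = s \<longleftrightarrow> t = s" if "t \<in> carrier W" for t
    using that assms by (metis gen_closed gen_square l_cancel m_assoc m_closed r_one one_closed)
  then have "count_list (map (\<lambda>t. s \<otimes> t \<otimes> s) xs) s = count_list xs s" if "set xs \<subseteq> carrier W" for xs
    using that by (induction xs) auto
  then show ?thesis using refl_seq_closed[OF assms(2)] by simp
qed

lemma odd_count_list: "odd (count_list xs x) \<Longrightarrow> x \<in> set xs"
  by (metis count_notin even_zero)

text \<open>Parity carries the occurrence of \<open>s\<close> over to a reduced word of the same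
  element, where deleting a letter gives a shorter word.\<close>

lemma odd_len_less:
  assumes "s \<in> S" "set u \<subseteq> S" "odd (count_list (refl_seq u) s)"
  shows "len (s \<otimes> wp u) < len (wp u)"
proof -
  obtain v where v: "set v \<subseteq> S" "length v = len (wp u)" "wp v = wp u"
    using reduced_word assms by (metis wp_closed)
  then have "s \<in> set (refl_seq v)"
    using refl_seq_parity[OF v(1) assms(2) v(3), of s] assms(3) odd_count_list by metis
  then obtain a r b where ab: "v = a @ r # b" "s \<otimes> wp v = wp (a @ b)"
    using refl_seq_delete[OF v(1)] by metis
  have "len (wp (a @ b)) \<le> length (a @ b)"
    using v(1) ab(1) by (intro len_le) auto
  then show ?thesis using v ab by simp
qed

lemma exchange:
  assumes "s \<in> S" "set u \<subseteq> S" "len (s \<otimes> wp u) \<le> len (wp u)"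
  shows "\<exists>a r b. u = a @ r # b \<and> s \<otimes> wp u = wp (a @ b)"
proof -
  have "odd (count_list (refl_seq u) s)"
  proof (rule ccontr)
    assume "\<not> ?thesis"
    \<comment> \<open>An even count for \<open>u\<close> is an odd count for \<open>s # u\<close>.
      Then \<open>s \<otimes> wp (s # u)\<close>, which is \<open>wp u\<close>, would be shorter
      than \<open>s \<otimes> wp u\<close>.\<close>
    then have "len (s \<otimes> wp (s # u)) < len (wp (s # u))"
      using assms refl_seq_Cons_parity odd_len_less[of s "s # u"] by auto
    then show False using assms by simp
  qed
  then show ?thesis using refl_seq_delete[OF assms(2)] odd_count_list by metis
qed

text \<open>The deletion property: as long as a word is not reduced, exchange removes two of its
  letters and keeps the product.\<close>

lemma reduced_subseq:
  assumes "set u \<subseteq> S"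
  shows "\<exists>v. subseq v u \<and> set v \<subseteq> S \<and> wp v = wp u \<and> length v = len (wp u)"
  using assms
proof (induction "length u" arbitrary: u rule: less_induct)
  case less
  show ?case
  proof (cases u)
    case Nil
    then show ?thesis by auto
  next
    case (Cons s u')
    then obtain v where v: "subseq v u'" "set v \<subseteq> S" "wp v = wp u'" "length v = len (wp u')"
      using less.hyps[of u'] less.prems by auto
    show ?thesis
    proof (cases "len (wp u) \<le> len (wp u')")
      case True
      \<comment> \<open>The letter \<open>s\<close> does not lengthen \<open>wp v\<close>, so
        exchange cancels it against a letter of \<open>v\<close>. What remains is a strictly shorter
        subword of \<open>u\<close>, ready for the induction.\<close>
      then obtain a r b where ab: "v = a @ r # b" "s \<otimes> wp v = wp (a @ b)"
        using exchange[of s v] v Cons less.prems by auto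
      have "subseq (a @ b) v" by (simp add: ab(1) subseq_append' list_emb_Cons)
      then have sub: "subseq (a @ b) u" using v(1) Cons by (meson list_emb_Cons subseq_order.trans)
      moreover have "length (a @ b) < length u"
        using list_emb_length[OF v(1)] ab(1) Cons by simp
      moreover have S: "set (a @ b) \<subseteq> S" using v(2) ab(1) by auto
      ultimately obtain c where c: "subseq c (a @ b)" "set c \<subseteq> S" "wp c = wp (a @ b)"
          "length c = len (wp (a @ b))"
        using less.hyps[of "a @ b"] by metis
      moreover have "wp (a @ b) = wp u" using ab(2) v(3) Cons by simp
      moreover have "subseq c u" using c(1) sub by (rule subseq_order.trans)
      ultimately show ?thesis by metis
    next
      case False
      then have "length (s # v) = len (wp u)"
        using len_le[of "s # v"] v Cons less.prems by auto
      then show ?thesis using v Cons less.prems by (intro exI[of _ "s # v"]) auto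
    qed
  qed
qed

section \<open>Parabolic subgroups and double cosets\<close>

lemma generate_mult: "x \<in> generate W K \<Longrightarrow> y \<in> generate W K \<Longrightarrow> x \<otimes> y \<in> generate W K"
  by (rule generate.eng)

lemma generate_inv: "K \<subseteq> S \<Longrightarrow> x \<in> generate W K \<Longrightarrow> inv x \<in> generate W K"
  by (rule generate_m_inv_closed) auto

lemma set_mono_subseq: "subseq u v \<Longrightarrow> set u \<subseteq> set v"
  by (auto elim: list_emb_set)

text \<open>Passing to a subword introduces no new letters, so the length in the whole group is
  attained by letters of \<open>K\<close>.\<close>

lemma generate_reduced:
  assumes "K \<subseteq> S" "x \<in> generate W K"
  obtains u where "set u \<subseteq> K" "wp u = x" "length u = len x"
proof -
  obtain u where u: "set u \<subseteq> K" "wp u = x" using assms generate_iff by auto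
  then obtain v where "subseq v u" "wp v = x" "length v = len x"
    using reduced_subseq[of u] assms by auto
  moreover have "set v \<subseteq> K" using calculation(1) u(1) set_mono_subseq by blast
  ultimately show ?thesis using that by blast
qed

lemma gen_in_generate_iff:
  assumes "K \<subseteq> S" "s \<in> S"
  shows "s \<in> generate W K \<longleftrightarrow> s \<in> K"
proof
  assume "s \<in> generate W K"
  then obtain u where "set u \<subseteq> K" "wp u = s" "length u = len s"
    using generate_reduced assms by metis
  then show "s \<in> K" using assms by (cases u) auto
qed (simp add: generate.incl)

text \<open>Exchange in a word over \<open>K\<close> shows that \<open>s \<otimes> x\<close> is
  again a product of letters of \<open>K\<close>. Hence \<open>s\<close> lies in
  \<open>generate W K\<close>, and a generator lying there belongs to \<open>K\<close>.\<close>

lemma left_descent_in_parabolic: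
  assumes "K \<subseteq> S" "x \<in> generate W K" "s \<in> S" "len (s \<otimes> x) \<le> len x"
  shows "s \<in> K"
proof -
  obtain u where u: "set u \<subseteq> K" "wp u = x" using assms generate_iff by auto
  then have "set u \<subseteq> S" using assms(1) by blast
  then obtain a r b where ab: "u = a @ r # b" "s \<otimes> x = wp (a @ b)"
    using exchange[of s u] assms u(2) by auto
  then have "wp (a @ b) \<in> generate W K"
    using u(1) by (intro iffD2[OF generate_iff[OF assms(1)]] exI[of _ "a @ b"]) auto
  then have "(s \<otimes> x) \<otimes> inv x \<in> generate W K"
    unfolding ab(2) using assms by (intro generate_mult generate_inv)
  then show ?thesis using gen_in_generate_iff assms by (simp add: m_assoc)
qed

lemma left_descent_exists:
  assumes "K \<subseteq> S" "x \<in> generate W K" "x \<noteq> \<one>"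
  obtains s where "s \<in> K" "len (s \<otimes> x) < len x"
proof -
  obtain u where u: "set u \<subseteq> K" "wp u = x" "length u = len x"
    using generate_reduced assms by metis
  then obtain s v where v: "u = s # v" using assms by (cases u) auto
  then have "s \<in> S" "set v \<subseteq> S" using u assms(1) by auto
  then have "s \<otimes> x = wp v" "len (wp v) \<le> length v" using u v by (auto intro: len_le)
  then show ?thesis using that[of s] u v by auto
qed

lemma inv_mult_gen:
  assumes "s \<in> S" "x \<in> carrier W"
  shows "len (s \<otimes> inv x) = len (x \<otimes> s)"
  using assms len_inv[of "x \<otimes> s"] by (simp add: inv_mult_group)

lemma right_descent_exists:
  assumes "K \<subseteq> S" "x \<in> generate W K" "x \<noteq> \<one>"
  obtains s where "s \<in> K" "len (x \<otimes> s) < len x"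
proof -
  have "inv x \<noteq> \<one>" using assms by (metis generate_closed inv_inv inv_one)
  then obtain s where "s \<in> K" "len (s \<otimes> inv x) < len (inv x)"
    using left_descent_exists[OF assms(1) generate_inv[OF assms(1,2)]] by blast
  then show ?thesis using that[of s] inv_mult_gen[of s x] len_inv[of x] assms
    by (auto simp: subset_iff)
qed

lemma generate_conjugate:
  assumes "B \<subseteq> S" "g \<in> carrier W" "\<And>b. b \<in> B \<Longrightarrow> g \<otimes> b \<otimes> inv g \<in> generate W L"
    "L \<subseteq> S" "x \<in> generate W B"
  shows "g \<otimes> x \<otimes> inv g \<in> generate W L"
  using assms(5)
proof induction
  case one
  then show ?case using assms by (simp add: generate.one)
next
  case (incl h)
  then show ?case using assms by simp
next
  case (inv h)
  then have "inv h = h" using assms(1) by auto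
  then show ?case using inv assms(3) by simp
next
  case (eng x y)
  have "x \<in> carrier W" "y \<in> carrier W" using eng.hyps assms(1) by auto
  then have "g \<otimes> (x \<otimes> y) \<otimes> inv g = (g \<otimes> x \<otimes> inv g) \<otimes> (g \<otimes> y \<otimes> inv g)"
    using assms(2) by (simp add: m_assoc)
  then show ?case using eng.IH generate_mult by metis
qed

lemma generate_commute:
  assumes "K \<subseteq> S" "g \<in> carrier W" "\<And>k. k \<in> K \<Longrightarrow> g \<otimes> k = k \<otimes> g" "x \<in> generate W K"
  shows "g \<otimes> x = x \<otimes> g"
  using assms(4)
proof induction
  case one
  then show ?case using assms by simp
next
  case (incl h)
  then show ?case using assms by simp
next
  case (inv h)
  then have "inv h = h" using assms(1) by auto
  then show ?case using inv assms(3) by simp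
next
  case (eng x y)
  have "x \<in> carrier W" "y \<in> carrier W" using eng.hyps assms(1) by auto
  then show ?case using eng.IH assms(2) by (metis m_assoc)
qed

text \<open>Letters of \<open>A\<close> can be collected on the left because they commute with the
  others. This separates a union of components from the remaining ones.\<close>

lemma generate_split:
  assumes "K \<subseteq> S" "A \<subseteq> K" "\<And>a b. a \<in> A \<Longrightarrow> b \<in> K - A \<Longrightarrow> a \<otimes> b = b \<otimes> a" "x \<in> generate W K"
  shows "\<exists>a \<in> generate W A. \<exists>b \<in> generate W (K - A). x = a \<otimes> b"
proof -
  obtain u where "set u \<subseteq> K" "wp u = x" using assms generate_iff by auto
  then show ?thesis
  proof (induction u arbitrary: x)
    case Nil
    then show ?case by (auto intro!: bexI[of _ "\<one>"] generate.one)
  next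
    case (Cons s u)
    then obtain a b where ab: "a \<in> generate W A" "b \<in> generate W (K - A)" "wp u = a \<otimes> b" by auto
    have A: "A \<subseteq> S" and B: "K - A \<subseteq> S" and s: "s \<in> S" "s \<in> K" using assms Cons.prems by auto
    have car: "a \<in> carrier W" "b \<in> carrier W" using generate_closed A B ab by blast+
    show ?case
    proof (cases "s \<in> A")
      case True
      then have "s \<otimes> a \<in> generate W A" using ab(1) by (rule generate_mult[OF generate.incl])
      moreover have "x = (s \<otimes> a) \<otimes> b" using Cons.prems ab s car by (simp add: m_assoc)
      ultimately show ?thesis using ab by blast
    next
      case False
      then have "s \<otimes> b \<in> generate W (K - A)" using ab(2) s by (intro generate_mult[OF generate.incl]) auto
      moreover have "s \<otimes> a = a \<otimes> s"
        using generate_commute[OF A gen_closed[OF s(1)] _ ab(1)] assms(3) False s(2) by (metis DiffI)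
      then have "s \<otimes> (a \<otimes> b) = a \<otimes> (s \<otimes> b)" using s car by (metis m_assoc gen_closed)
      then have "x = a \<otimes> (s \<otimes> b)" using Cons.prems(2) ab(3) by simp
      ultimately show ?thesis using ab by blast
    qed
  qed
qed

section \<open>Double cosets and their shortest elements\<close>

lemma double_coset_iff:
  assumes "I \<subseteq> S" "J \<subseteq> S" "x \<in> carrier W"
  shows "y \<in> double_coset W I x J \<longleftrightarrow> (\<exists>u \<in> generate W I. \<exists>v \<in> generate W J. y = u \<otimes> x \<otimes> v)"
  unfolding double_coset_def r_coset_def set_mult_def by blast

lemma double_coset_closed:
  assumes "I \<subseteq> S" "J \<subseteq> S" "x \<in> carrier W" "y \<in> double_coset W I x J"
  shows "y \<in> carrier W"
  using assms by (auto simp: double_coset_iff)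

lemma double_coset_self:
  assumes "I \<subseteq> S" "J \<subseteq> S" "x \<in> carrier W"
  shows "x \<in> double_coset W I x J"
  unfolding double_coset_iff[OF assms] using assms(3)
  by (intro bexI[of _ "\<one>"] generate.one) simp

lemma double_coset_mult_left:
  assumes "I \<subseteq> S" "J \<subseteq> S" "x \<in> carrier W" "y \<in> double_coset W I x J" "u \<in> generate W I"
  shows "u \<otimes> y \<in> double_coset W I x J"
proof -
  obtain a b where ab: "a \<in> generate W I" "b \<in> generate W J" "y = a \<otimes> x \<otimes> b"
    using assms double_coset_iff by auto
  then have "u \<otimes> y = (u \<otimes> a) \<otimes> x \<otimes> b" using assms by (simp add: m_assoc)
  then show ?thesis using assms ab generate_mult by (auto simp: double_coset_iff)
qed

lemma double_coset_mult_right: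
  assumes "I \<subseteq> S" "J \<subseteq> S" "x \<in> carrier W" "y \<in> double_coset W I x J" "v \<in> generate W J"
  shows "y \<otimes> v \<in> double_coset W I x J"
proof -
  obtain a b where ab: "a \<in> generate W I" "b \<in> generate W J" "y = a \<otimes> x \<otimes> b"
    using assms double_coset_iff by auto
  then have "y \<otimes> v = a \<otimes> x \<otimes> (b \<otimes> v)" using assms by (simp add: m_assoc)
  then show ?thesis using assms ab generate_mult by (metis double_coset_iff)
qed

lemma double_coset_subset:
  assumes "I \<subseteq> S" "J \<subseteq> S" "x \<in> carrier W" "y \<in> double_coset W I x J"
  shows "double_coset W I y J \<subseteq> double_coset W I x J"
proof
  fix z assume "z \<in> double_coset W I y J"
  moreover have "y \<in> carrier W" using double_coset_closed assms by blast
  ultimately obtain u v where "u \<in> generate W I" "v \<in> generate W J" "z = u \<otimes> y \<otimes> v"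
    using assms double_coset_iff by auto
  then show "z \<in> double_coset W I x J"
    using assms double_coset_mult_left double_coset_mult_right by metis
qed

lemma double_coset_eq:
  assumes "I \<subseteq> S" "J \<subseteq> S" "x \<in> carrier W" "y \<in> double_coset W I x J"
  shows "double_coset W I y J = double_coset W I x J"
proof
  obtain u v where uv: "u \<in> generate W I" "v \<in> generate W J" "y = u \<otimes> x \<otimes> v"
    using assms double_coset_iff by auto
  have y: "y \<in> carrier W" using double_coset_closed assms by blast
  have "x = inv u \<otimes> y \<otimes> inv v" using uv assms by (simp add: m_assoc)
  then have "x \<in> double_coset W I y J"
    using double_coset_iff[OF assms(1,2) y] generate_inv uv assms by blast
  then show "double_coset W I x J \<subseteq> double_coset W I y J"
    using double_coset_subset assms y by blast
qed (rule double_coset_subset[OF assms])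

lemma double_coset_mono:
  assumes "I \<subseteq> I'" "J \<subseteq> J'" "I' \<subseteq> S" "J' \<subseteq> S" "x \<in> carrier W"
  shows "double_coset W I x J \<subseteq> double_coset W I' x J'"
proof
  fix y assume y: "y \<in> double_coset W I x J"
  have "I \<subseteq> S" "J \<subseteq> S" using assms by auto
  then obtain u v where "u \<in> generate W I" "v \<in> generate W J" "y = u \<otimes> x \<otimes> v"
    using y double_coset_iff[OF _ _ assms(5)] by blast
  then show "y \<in> double_coset W I' x J'"
    using double_coset_iff[OF assms(3,4) assms(5)] mono_generate[OF assms(1)] mono_generate[OF assms(2)]
    by blast
qed

lemma double_coset_inv:
  assumes "I \<subseteq> S" "J \<subseteq> S" "x \<in> carrier W"
  shows "double_coset W J (inv x) I = m_inv W ` double_coset W I x J"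
proof -
  have sub: "m_inv W ` double_coset W I x J \<subseteq> double_coset W J (inv x) I"
    if *: "I \<subseteq> S" "J \<subseteq> S" "x \<in> carrier W" for I J x
  proof
    fix y assume "y \<in> m_inv W ` double_coset W I x J"
    then obtain u v where uv: "u \<in> generate W I" "v \<in> generate W J" "y = inv (u \<otimes> x \<otimes> v)"
      using double_coset_iff[OF *] by auto
    then have "y = inv v \<otimes> inv x \<otimes> inv u" using * by (simp add: group_simps)
    then show "y \<in> double_coset W J (inv x) I"
      using double_coset_iff[OF *(2,1), of "inv x"] generate_inv uv(1,2) * by blast
  qed
  show ?thesis
  proof
    show "double_coset W J (inv x) I \<subseteq> m_inv W ` double_coset W I x J"
    proof
      fix y assume y: "y \<in> double_coset W J (inv x) I"
      then have "inv y \<in> double_coset W I x J"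
        using subsetD[OF sub[of J I "inv x"], of "inv y"] assms by simp
      moreover have "y \<in> carrier W" using double_coset_closed y assms by blast
      ultimately show "y \<in> m_inv W ` double_coset W I x J" by (intro image_eqI[of _ _ "inv y"]) auto
    qed
  qed (rule sub[OF assms])
qed

text \<open>The working notion of minimality. For double cosets it turns out to agree both with
  membership in \<open>min_double_reps\<close> and with being the Bruhat minimum.\<close>

definition shortest_in :: "'a \<Rightarrow> 'a set \<Rightarrow> bool" where
  "shortest_in x C \<longleftrightarrow> x \<in> C \<and> (\<forall>y \<in> C. len x \<le> len y)"

lemma shortest_in_exists: "C \<noteq> {} \<Longrightarrow> \<exists>x. shortest_in x C"
  unfolding shortest_in_def using ex_has_least_nat[of "\<lambda>x. x \<in> C"] by (metis ex_in_conv)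

text \<open>Concatenate words for the three factors of \<open>y\<close> and pass to a reduced
  subword. It meets each block in a subword, and minimality of \<open>x\<close> forces the middle
  block to survive intact.\<close>

lemma double_coset_reduced_words:
  assumes "I \<subseteq> S" "J \<subseteq> S" "x \<in> carrier W" "shortest_in x (double_coset W I x J)"
    and "y \<in> double_coset W I x J"
  obtains u v where "set u \<subseteq> I" "set v \<subseteq> J" "y = wp u \<otimes> x \<otimes> wp v" "len y = length u + len x + length v"
proof -
  obtain p q where "p \<in> generate W I" "q \<in> generate W J" and y: "y = p \<otimes> x \<otimes> q"
    using assms double_coset_iff by auto
  then obtain a c where a: "set a \<subseteq> I" "wp a = p" and c: "set c \<subseteq> J" "wp c = q"
    using generate_iff assms by metis
  obtain b where b: "set b \<subseteq> S" "length b = len x" "wp b = x" using reduced_word assms by metis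
  have S: "set a \<subseteq> S" "set c \<subseteq> S" using a c assms by auto
  then have "wp (a @ b @ c) = wp a \<otimes> wp b \<otimes> wp c" using b(1) by (simp add: m_assoc)
  then have "wp (a @ b @ c) = y" using a b c y by simp
  then obtain d where d: "subseq d (a @ b @ c)" "wp d = y" "length d = len y"
    using reduced_subseq[of "a @ b @ c"] S b by force
  then obtain a' d' where a': "d = a' @ d'" "subseq a' a" "subseq d' (b @ c)"
    by (metis subseq_appendE)
  then obtain b' c' where b': "d' = b' @ c'" "subseq b' b" "subseq c' c"
    by (metis subseq_appendE)
  have sets: "set a' \<subseteq> I" "set b' \<subseteq> S" "set c' \<subseteq> J"
    using set_mono_subseq[OF a'(2)] set_mono_subseq[OF b'(2)] set_mono_subseq[OF b'(3)] a b c by auto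
  then have S': "set a' \<subseteq> S" "set c' \<subseteq> S" using assms by auto
  then have y': "y = wp a' \<otimes> wp b' \<otimes> wp c'" using d(2) a' b' sets by (simp add: m_assoc)
  have car: "wp a' \<in> carrier W" "wp b' \<in> carrier W" "wp c' \<in> carrier W" using S' sets by auto
  have gen: "wp a' \<in> generate W I" "wp c' \<in> generate W J" using sets generate_iff assms by blast+
  \<comment> \<open>The element \<open>wp b'\<close> lies in the same double coset, so it is no
    shorter than \<open>x\<close>. Being a subword of the reduced word \<open>b\<close>, the word
    \<open>b'\<close> is therefore all of \<open>b\<close>.\<close>
  have "wp b' = inv (wp a') \<otimes> y \<otimes> inv (wp c')" unfolding y' using car by (simp add: m_assoc)
  then have "wp b' \<in> double_coset W I x J"
    using double_coset_mult_left double_coset_mult_right generate_inv gen assms by metis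
  then have "length b \<le> length b'"
    using assms(4) b(2) len_le[OF sets(2)] by (auto simp: shortest_in_def)
  then have "b' = b" using b'(2) by (metis list_emb_length order_antisym subseq_same_length)
  then show ?thesis using that[of a' c'] sets y' d(3) a' b' b by simp
qed

lemma double_coset_reduced:
  assumes "I \<subseteq> S" "J \<subseteq> S" "x \<in> carrier W" "shortest_in x (double_coset W I x J)"
    and "y \<in> double_coset W I x J"
  obtains u v where "u \<in> generate W I" "v \<in> generate W J" "y = u \<otimes> x \<otimes> v" "len y = len u + len x + len v"
proof -
  obtain u v where uv: "set u \<subseteq> I" "set v \<subseteq> J" "y = wp u \<otimes> x \<otimes> wp v" "len y = length u + len x + length v"
    using double_coset_reduced_words[OF assms] by blast
  then have S: "set u \<subseteq> S" "set v \<subseteq> S" using assms by auto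
  then have "len y \<le> len (wp u) + len x + len (wp v)"
    using uv(3) len_mult_le[of "wp u" x] len_mult_le[of "wp u \<otimes> x" "wp v"] assms by fastforce
  then have "len y = len (wp u) + len x + len (wp v)"
    using uv(4) len_le[OF S(1)] len_le[OF S(2)] by simp
  moreover have "wp u \<in> generate W I" "wp v \<in> generate W J" using uv generate_iff assms by blast+
  ultimately show ?thesis using that uv by blast
qed

lemma shortest_in_inv:
  assumes "I \<subseteq> S" "J \<subseteq> S" "x \<in> carrier W" "shortest_in x (double_coset W I x J)"
  shows "shortest_in (inv x) (double_coset W J (inv x) I)"
proof -
  have "len (inv y) = len y" if "y \<in> double_coset W I x J" for y
    using len_inv double_coset_closed assms that by blast
  then show ?thesis using assms by (auto simp: double_coset_inv shortest_in_def)
qed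

text \<open>The element \<open>x\<close> is also shortest in \<open>double_coset W I x {}\<close>.
  There the right factor of a length-additive factorization is trivial, so the left factor can only
  be \<open>u\<close>.\<close>

lemma len_mult_shortest_left:
  assumes "I \<subseteq> S" "J \<subseteq> S" "x \<in> carrier W" "shortest_in x (double_coset W I x J)" "u \<in> generate W I"
  shows "len (u \<otimes> x) = len u + len x"
proof -
  have iff: "y \<in> double_coset W I x {} \<longleftrightarrow> (\<exists>u \<in> generate W I. y = u \<otimes> x)" for y
    using assms by (auto simp: double_coset_iff generate_empty)
  have "double_coset W I x {} \<subseteq> double_coset W I x J"
    using assms double_coset_mult_left double_coset_self by (auto simp: iff)
  then have "shortest_in x (double_coset W I x {})"
    using assms double_coset_self[of I "{}" x] by (auto simp: shortest_in_def)
  moreover have "u \<otimes> x \<in> double_coset W I x {}" using assms iff by blast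
  ultimately obtain a b where "a \<in> generate W I" "b \<in> generate W {}" "u \<otimes> x = a \<otimes> x \<otimes> b"
      "len (u \<otimes> x) = len a + len x + len b"
    using double_coset_reduced[of I "{}" x] assms by blast
  then show ?thesis using assms by (auto simp: generate_empty)
qed

lemma len_mult_shortest_right:
  assumes "I \<subseteq> S" "J \<subseteq> S" "x \<in> carrier W" "shortest_in x (double_coset W I x J)" "v \<in> generate W J"
  shows "len (x \<otimes> v) = len x + len v"
proof -
  have v: "v \<in> carrier W" using assms by auto
  have "len (inv v \<otimes> inv x) = len (inv v) + len (inv x)"
    using assms generate_inv by (intro len_mult_shortest_left[OF assms(2,1) _ shortest_in_inv]) auto
  then show ?thesis
    using len_inv[of "x \<otimes> v"] len_inv[of x] len_inv[of v] v assms(3) by (simp add: inv_mult_group)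
qed

lemma shortest_in_unique:
  assumes "I \<subseteq> S" "J \<subseteq> S" "x \<in> carrier W" "shortest_in x (double_coset W I x J)"
    "shortest_in y (double_coset W I x J)"
  shows "y = x"
proof -
  obtain u v where uv: "u \<in> generate W I" "v \<in> generate W J" "y = u \<otimes> x \<otimes> v" "len y = len u + len x + len v"
    using double_coset_reduced[OF assms(1-4), of y] assms(5) unfolding shortest_in_def by blast
  moreover have "len y \<le> len x" using assms by (auto simp: shortest_in_def)
  ultimately show ?thesis using assms by (auto simp: len_eq_0)
qed

text \<open>Local minimality implies global minimality: write \<open>w\<close> as a length-additive
  product around a shortest element. A nontrivial outer factor would have a descent in
  \<open>I\<close> or \<open>J\<close>, and this descent would shorten \<open>w\<close> too.\<close>

lemma min_double_reps_iff:
  assumes "I \<subseteq> S" "J \<subseteq> S"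
  shows "w \<in> min_double_reps W S I J \<longleftrightarrow> w \<in> carrier W \<and> shortest_in w (double_coset W I w J)"
proof
  assume w: "w \<in> min_double_reps W S I J"
  then have car: "w \<in> carrier W" by (simp add: min_double_reps_def)
  have "double_coset W I w J \<noteq> {}" using double_coset_self[OF assms car] by blast
  then obtain x where x: "shortest_in x (double_coset W I w J)" using shortest_in_exists by blast
  then have xin: "x \<in> double_coset W I w J" by (simp add: shortest_in_def)
  then have xcar: "x \<in> carrier W" using double_coset_closed assms car by blast
  have eq: "double_coset W I x J = double_coset W I w J" using double_coset_eq assms car xin by blast
  then have "shortest_in x (double_coset W I x J)" "w \<in> double_coset W I x J"
    using x double_coset_self[OF assms car] by simp_all
  then obtain u v where uv: "u \<in> generate W I" "v \<in> generate W J" "w = u \<otimes> x \<otimes> v"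
      "len w = len u + len x + len v"
    using double_coset_reduced[OF assms xcar] by blast
  have uvc: "u \<in> carrier W" "v \<in> carrier W" using uv assms by auto
  have "u = \<one>"
  proof (rule ccontr)
    assume "u \<noteq> \<one>"
    then obtain s where s: "s \<in> I" "len (s \<otimes> u) < len u" using left_descent_exists assms uv by metis
    have sc: "s \<in> carrier W" using s assms by auto
    have "len (s \<otimes> w) \<le> len (s \<otimes> u) + len x + len v"
      using uv(3) len_mult_le[of "s \<otimes> u" x] len_mult_le[of "s \<otimes> u \<otimes> x" v] uvc xcar sc
      by (simp add: m_assoc)
    then show False using uv(4) s w by (auto simp: min_double_reps_def)
  qed
  moreover have "v = \<one>"
  proof (rule ccontr)
    assume "v \<noteq> \<one>"
    then obtain s where s: "s \<in> J" "len (v \<otimes> s) < len v" using right_descent_exists assms uv by metis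
    have sc: "s \<in> carrier W" using s assms by auto
    have "len (w \<otimes> s) \<le> len u + len x + len (v \<otimes> s)"
      using uv(3) len_mult_le[of u x] len_mult_le[of "u \<otimes> x" "v \<otimes> s"] uvc xcar sc
      by (simp add: m_assoc)
    then show False using uv(4) s w by (auto simp: min_double_reps_def)
  qed
  ultimately have "w = x" using uv(3) xcar by simp
  then show "w \<in> carrier W \<and> shortest_in w (double_coset W I w J)"
    using x xcar by simp
next
  assume w: "w \<in> carrier W \<and> shortest_in w (double_coset W I w J)"
  have "len (s \<otimes> w) > len w" if s: "s \<in> I" for s
    using len_mult_shortest_left[of I J w s] w assms s by (auto simp: generate.incl)
  moreover have "len (w \<otimes> s) > len w" if s: "s \<in> J" for s
    using len_mult_shortest_right[of I J w s] w assms s by (auto simp: generate.incl)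
  ultimately show "w \<in> min_double_reps W S I J" using w by (simp add: min_double_reps_def)
qed

section \<open>Bruhat minima of double cosets\<close>

lemma bruhat_step_len: "bruhat_step W S x y \<Longrightarrow> len x < len y"
  by (simp add: bruhat_step_def)

lemma bruhat_le_len: "bruhat_le W S x y \<Longrightarrow> len x \<le> len y"
  unfolding bruhat_le_def
  by (induction rule: rtranclp_induct) (use bruhat_step_len in fastforce)+

text \<open>The total length is the largest possible, so each appended letter raises the length and
  is a Bruhat step.\<close>

lemma bruhat_le_mult_right:
  assumes "x \<in> carrier W" "set v \<subseteq> S" "len (x \<otimes> wp v) = len x + length v"
  shows "bruhat_le W S x (x \<otimes> wp v)"
  using assms(2,3)
proof (induction v rule: rev_induct)
  case Nil
  then show ?case using assms(1) by (simp add: bruhat_le_def)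
next
  case (snoc t v)
  let ?y = "x \<otimes> wp v"
  have t: "t \<in> S" and v: "set v \<subseteq> S" using snoc.prems by auto
  have eq: "x \<otimes> wp (v @ [t]) = ?y \<otimes> t" using t v assms(1) by (simp add: m_assoc)
  have "len (?y \<otimes> t) \<le> len ?y + 1" using len_mult_le[of ?y t] t v assms(1) by simp
  moreover have "len ?y \<le> len x + length v"
    using len_mult_le[of x "wp v"] len_le[OF v] v assms(1) by simp
  ultimately have len: "len ?y = len x + length v" "len ?y < len (?y \<otimes> t)"
    using snoc.prems(2) eq by auto
  have "t \<in> reflections W S" unfolding reflections_def using t
    by (intro CollectI exI[of _ "\<one>"] exI[of _ t]) auto
  then have "bruhat_step W S ?y (?y \<otimes> t)"
    using len v assms(1) by (auto simp: bruhat_step_def)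
  then show ?case using snoc.IH[OF v len(1)] unfolding eq bruhat_le_def by (rule rtranclp.rtrancl_into_rtrancl[rotated])
qed

lemma bruhat_le_mult_left:
  assumes "x \<in> carrier W" "set u \<subseteq> S" "len (wp u \<otimes> x) = length u + len x"
  shows "bruhat_le W S x (wp u \<otimes> x)"
  using assms(2,3)
proof (induction u)
  case Nil
  then show ?case using assms(1) by (simp add: bruhat_le_def)
next
  case (Cons s u)
  let ?y = "wp u \<otimes> x"
  have s: "s \<in> S" and u: "set u \<subseteq> S" using Cons.prems by auto
  then have y: "?y \<in> carrier W" using assms(1) by simp
  have eq: "wp (s # u) \<otimes> x = s \<otimes> ?y" using s u assms(1) by (simp add: m_assoc)
  have "len (s \<otimes> ?y) \<le> 1 + len ?y" using len_mult_le[of s ?y] s y by simp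
  moreover have "len ?y \<le> length u + len x"
    using len_mult_le[of "wp u" x] len_le[OF u] u assms(1) by simp
  ultimately have len: "len ?y = length u + len x" "len ?y < len (s \<otimes> ?y)"
    using Cons.prems(2) eq by auto
  \<comment> \<open>Bruhat steps multiply by a reflection on the right, so left multiplication by
    \<open>s\<close> is rewritten with a conjugate of \<open>s\<close>.\<close>
  have "inv ?y \<otimes> s \<otimes> ?y \<in> reflections W S" unfolding reflections_def using s y
    by (intro CollectI exI[of _ "inv ?y"] exI[of _ s]) simp
  moreover have "s \<otimes> ?y = ?y \<otimes> (inv ?y \<otimes> s \<otimes> ?y)"
    using s y by (simp add: m_assoc[of "inv ?y"])
  ultimately have "bruhat_step W S ?y (s \<otimes> ?y)"
    using len y unfolding bruhat_step_def by blast
  then show ?case using Cons.IH[OF u len(1)] unfolding eq bruhat_le_def by (rule rtranclp.rtrancl_into_rtrancl[rotated])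
qed

text \<open>A length-additive factorization lets one climb from \<open>w\<close> first to
  \<open>w \<otimes> wp v\<close> and then to \<open>y\<close>. Conversely, going up in Bruhat order
  never lowers the length.\<close>

lemma bruhat_minimum_iff:
  assumes "I \<subseteq> S" "J \<subseteq> S" "x \<in> carrier W"
  shows "bruhat_minimum W S (double_coset W I x J) w \<longleftrightarrow> shortest_in w (double_coset W I x J)"
proof
  assume w: "shortest_in w (double_coset W I x J)"
  then have win: "w \<in> double_coset W I x J" by (simp add: shortest_in_def)
  then have car: "w \<in> carrier W" using double_coset_closed assms by blast
  have eq: "double_coset W I w J = double_coset W I x J" using double_coset_eq assms win by blast
  have "bruhat_le W S w y" if y: "y \<in> double_coset W I x J" for y
  proof -
    obtain u v where uv: "set u \<subseteq> I" "set v \<subseteq> J" "y = wp u \<otimes> w \<otimes> wp v"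
        "len y = length u + len w + length v"
      using double_coset_reduced_words[OF assms(1,2) car, of y] w y unfolding eq by blast
    then have S: "set u \<subseteq> S" "set v \<subseteq> S" using assms by auto
    \<comment> \<open>Additivity for the whole product forces additivity for the partial product
      \<open>w \<otimes> wp v\<close>.\<close>
    have "len y \<le> length u + len (w \<otimes> wp v)" "len (w \<otimes> wp v) \<le> len w + length v"
      using len_mult_le[of "wp u" "w \<otimes> wp v"] len_mult_le[of w "wp v"] len_le[OF S(1)] len_le[OF S(2)]
        S car uv(3) by (simp_all add: m_assoc)
    then have "len (w \<otimes> wp v) = len w + length v" using uv(4) by simp
    moreover from this have "len (wp u \<otimes> (w \<otimes> wp v)) = length u + len (w \<otimes> wp v)"
      using uv(3,4) S car by (simp add: m_assoc)
    ultimately have "bruhat_le W S w (w \<otimes> wp v)" "bruhat_le W S (w \<otimes> wp v) (wp u \<otimes> (w \<otimes> wp v))"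
      using bruhat_le_mult_left bruhat_le_mult_right S car by auto
    then show ?thesis using uv(3) S car by (simp add: bruhat_le_def m_assoc)
  qed
  then show "bruhat_minimum W S (double_coset W I x J) w" using win by (simp add: bruhat_minimum_def)
qed (auto simp: bruhat_minimum_def shortest_in_def bruhat_le_len)

section \<open>Components of the Coxeter graph\<close>

text \<open>For generators this is adjacency in the Coxeter graph. Noncommutation has the advantage
  of being visibly preserved by conjugation.\<close>

definition noncommuting :: "'a set \<Rightarrow> ('a \<times> 'a) set" where
  "noncommuting M = {(s, t). s \<in> M \<and> t \<in> M \<and> s \<otimes> t \<noteq> t \<otimes> s}"

definition component :: "'a set \<Rightarrow> 'a \<Rightarrow> 'a set" where
  "component M s = {t. (s, t) \<in> (noncommuting M)\<^sup>*}"

lemma coxeter_adj_iff: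
  assumes "s \<in> S" "t \<in> S"
  shows "coxeter_adj W s t \<longleftrightarrow> s \<otimes> t \<noteq> t \<otimes> s"
proof -
  have car: "s \<in> carrier W" "t \<in> carrier W" using assms by auto
  have "(s \<otimes> t) [^] (2::nat) = s \<otimes> t \<otimes> (s \<otimes> t)" using car by (simp add: numeral_2_eq_2)
  moreover have "s \<otimes> t \<otimes> (s \<otimes> t) = \<one> \<longleftrightarrow> s \<otimes> t = t \<otimes> s"
  proof
    assume "s \<otimes> t \<otimes> (s \<otimes> t) = \<one>"
    then have "inv (s \<otimes> t) = s \<otimes> t" using car by (intro inv_equality) auto
    then show "s \<otimes> t = t \<otimes> s" using assms car by (simp add: inv_mult_group)
  next
    assume "s \<otimes> t = t \<otimes> s"
    then have "s \<otimes> t \<otimes> (s \<otimes> t) = s \<otimes> t \<otimes> (t \<otimes> s)" by simp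
    also have "\<dots> = \<one>" using assms car by (simp add: m_assoc)
    finally show "s \<otimes> t \<otimes> (s \<otimes> t) = \<one>" .
  qed
  ultimately have "s \<otimes> t = t \<otimes> s \<longleftrightarrow> ord (s \<otimes> t) dvd 2"
    using pow_eq_id[of "s \<otimes> t" 2] car by simp
  \<comment> \<open>The value 0, which encodes infinite order, does not divide 2 and so falls on the
    side of adjacency.\<close>
  moreover have "n dvd 2 \<longleftrightarrow> \<not> (n = 0 \<or> n > 2)" for n :: nat
  proof
    assume "n dvd 2"
    then show "\<not> (n = 0 \<or> n > 2)" using dvd_imp_le[of n 2] by (cases "n = 0") auto
  next
    assume "\<not> (n = 0 \<or> n > 2)"
    then have "n = 1 \<or> n = 2" by linarith
    then show "n dvd 2" by auto
  qed
  ultimately show ?thesis unfolding coxeter_adj_def by auto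
qed

lemma component_refl: "s \<in> component M s"
  by (simp add: component_def)

lemma component_subset: "s \<in> M \<Longrightarrow> component M s \<subseteq> M"
proof
  fix t assume "s \<in> M" "t \<in> component M s"
  then have "(s, t) \<in> (noncommuting M)\<^sup>*" by (simp add: component_def)
  then show "t \<in> M" by (cases rule: rtranclE) (use \<open>s \<in> M\<close> in \<open>auto simp: noncommuting_def\<close>)
qed

lemma component_sym: "t \<in> component M s \<Longrightarrow> s \<in> component M t"
proof -
  have "sym ((noncommuting M)\<^sup>*)" by (intro sym_rtrancl) (auto simp: sym_def noncommuting_def)
  then show "t \<in> component M s \<Longrightarrow> s \<in> component M t"
    unfolding component_def by (auto dest: symD)
qed

lemma component_trans: "t \<in> component M s \<Longrightarrow> r \<in> component M t \<Longrightarrow> r \<in> component M s"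
  unfolding component_def by auto

lemma component_eq: "t \<in> component M s \<Longrightarrow> component M t = component M s"
  using component_trans component_sym by blast

lemma component_step:
  "s \<in> M \<Longrightarrow> t \<in> component M s \<Longrightarrow> r \<in> M \<Longrightarrow> t \<otimes> r \<noteq> r \<otimes> t \<Longrightarrow> r \<in> component M s"
  using component_subset[of s M] by (auto simp: component_def noncommuting_def intro: rtrancl_into_rtrancl)

lemma component_mono: "A \<subseteq> B \<Longrightarrow> component A s \<subseteq> component B s"
proof -
  assume "A \<subseteq> B"
  then have "noncommuting A \<subseteq> noncommuting B" by (auto simp: noncommuting_def)
  then show ?thesis using rtrancl_mono unfolding component_def by blast
qed

text \<open>The last assumption makes \<open>A\<close> a union of components of \<open>M\<close>: a
  walk in \<open>M\<close> that starts in \<open>A\<close> never leaves it.\<close>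

lemma component_closed:
  assumes "A \<subseteq> M" "s \<in> A" "\<And>a m. a \<in> A \<Longrightarrow> m \<in> M \<Longrightarrow> a \<otimes> m \<noteq> m \<otimes> a \<Longrightarrow> m \<in> A"
  shows "component A s = component M s"
proof
  show "component M s \<subseteq> component A s"
  proof
    fix t assume "t \<in> component M s"
    then have "(s, t) \<in> (noncommuting M)\<^sup>*" by (simp add: component_def)
    then show "t \<in> component A s"
    proof induction
      case base
      then show ?case by (rule component_refl)
    next
      case (step y z)
      then have "y \<in> A" using component_subset[OF assms(2)] by auto
      then show ?case
        using step component_step[OF assms(2)] assms(3)[of y z] by (auto simp: noncommuting_def)
    qed
  qed
qed (rule component_mono[OF assms(1)])

text \<open>Conjugation preserves noncommutation, so it carries a walk in \<open>M\<close> to a walk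
  in \<open>N\<close>.\<close>

lemma component_conjugate:
  assumes "M \<subseteq> carrier W" "g \<in> carrier W" "\<And>t. t \<in> component M s \<Longrightarrow> g \<otimes> t \<otimes> inv g \<in> N" "t \<in> component M s" "s \<in> M"
  shows "g \<otimes> t \<otimes> inv g \<in> component N (g \<otimes> s \<otimes> inv g)"
proof -
  have "(s, t) \<in> (noncommuting M)\<^sup>*" using assms by (simp add: component_def)
  then show ?thesis
  proof induction
    case base
    then show ?case by (rule component_refl)
  next
    case (step y z)
    then have y: "y \<in> component M s" "z \<in> component M s" and neq: "y \<otimes> z \<noteq> z \<otimes> y"
      by (auto simp: component_def noncommuting_def intro: rtrancl_into_rtrancl)
    have car: "y \<in> carrier W" "z \<in> carrier W"
      using y component_subset[OF assms(5)] assms(1) by auto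
    have "(g \<otimes> y \<otimes> inv g) \<otimes> (g \<otimes> z \<otimes> inv g) = g \<otimes> (y \<otimes> z) \<otimes> inv g"
      "(g \<otimes> z \<otimes> inv g) \<otimes> (g \<otimes> y \<otimes> inv g) = g \<otimes> (z \<otimes> y) \<otimes> inv g"
      using car assms(2) by (simp_all add: m_assoc)
    then have "(g \<otimes> y \<otimes> inv g) \<otimes> (g \<otimes> z \<otimes> inv g) \<noteq> (g \<otimes> z \<otimes> inv g) \<otimes> (g \<otimes> y \<otimes> inv g)"
      using neq car assms(2) by simp
    moreover have "g \<otimes> s \<otimes> inv g \<in> N" using assms(3) component_refl by blast
    ultimately show ?case using component_step[OF _ step.IH] assms(3)[OF y(2)] by blast
  qed
qed

text \<open>The vertex \<open>t\<close> is the one after the last visit to \<open>s\<close>; from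
  there the walk avoids \<open>s\<close>. This permits induction on the size of
  \<open>M\<close>.\<close>

lemma component_first_step:
  assumes "r \<in> component M s" "r \<noteq> s"
  shows "\<exists>t \<in> M - {s}. s \<otimes> t \<noteq> t \<otimes> s \<and> r \<in> component (M - {s}) t"
proof -
  have "(s, r) \<in> (noncommuting M)\<^sup>*" using assms by (simp add: component_def)
  then show ?thesis using assms(2)
  proof induction
    case base
    then show ?case by simp
  next
    case (step y z)
    then have yz: "z \<in> M - {s}" "y \<in> M" "y \<otimes> z \<noteq> z \<otimes> y" by (auto simp: noncommuting_def)
    show ?case
    proof (cases "y = s")
      case True
      then show ?thesis using yz component_refl by blast
    next
      case False
      then obtain t where "t \<in> M - {s}" "s \<otimes> t \<noteq> t \<otimes> s" "y \<in> component (M - {s}) t" using step.IH by blast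
      then show ?thesis using component_step[of t "M - {s}" y z] yz by blast
    qed
  qed
qed

lemma coxeter_components_eq:
  assumes "M \<subseteq> S"
  shows "coxeter_components W M = component M ` M"
proof -
  have "{(a, b). a \<in> M \<and> b \<in> M \<and> coxeter_adj W a b} = noncommuting M"
    using assms coxeter_adj_iff by (auto simp: noncommuting_def)
  then have "coxeter_components W M = (\<Union>s \<in> M. {{t. s \<in> M \<and> t \<in> M \<and> t \<in> component M s}})"
    by (auto simp: coxeter_components_def quotient_def component_def Image_def)
  also have "\<dots> = component M ` M" using component_subset by fastforce
  finally show ?thesis .
qed

section \<open>Elements with at most one, prescribed left descent, and the rigidity of
  components\<close>

definition descents_only :: "'a \<Rightarrow> 'a \<Rightarrow> bool" where
  "descents_only s x \<longleftrightarrow> (\<forall>t \<in> S. len (t \<otimes> x) < len x \<longrightarrow> t = s)"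

text \<open>Suppose \<open>t \<noteq> s\<close> is a descent of \<open>s \<otimes> x\<close>. Two
  exchanges then leave only the outcomes that \<open>t = r\<close> commutes with \<open>s\<close>,
  or that \<open>s\<close> lies in \<open>K\<close>, both excluded.\<close>

lemma descents_only_step:
  assumes K: "K \<subseteq> S" and s: "s \<in> S" "s \<notin> K" and x: "x \<in> generate W K"
    and only: "descents_only r x" and neq: "s \<otimes> r \<noteq> r \<otimes> s"
  shows "descents_only s (s \<otimes> x)"
  unfolding descents_only_def
proof (intro ballI impI)
  fix t assume t: "t \<in> S" "len (t \<otimes> (s \<otimes> x)) < len (s \<otimes> x)"
  have xc: "x \<in> carrier W" using x K by simp
  have sc: "s \<in> carrier W" and tc: "t \<in> carrier W" using s t by auto
  have "\<not> len (s \<otimes> x) \<le> len x" using left_descent_in_parabolic[OF K x s(1)] s(2) by blast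
  then have lsx: "len (s \<otimes> x) = len x + 1" using len_mult_le[OF sc xc] s(1) by simp
  obtain b where b: "set b \<subseteq> S" "length b = len x" "wp b = x" using reduced_word xc by metis
  show "t = s"
  proof (rule ccontr)
    assume ts: "t \<noteq> s"
    obtain a q d where a: "s # b = a @ q # d" "t \<otimes> (s \<otimes> x) = wp (a @ d)"
      using exchange[of t "s # b"] b s t by auto
    \<comment> \<open>If the exchange deleted the leading \<open>s\<close>, then
      \<open>t \<otimes> s = \<one>\<close> and \<open>t = s\<close>.\<close>
    obtain a' where a': "a = s # a'"
    proof (cases a)
      case Nil
      then have "t \<otimes> (s \<otimes> x) = x" using a b by simp
      then have "t \<otimes> s \<otimes> x = \<one> \<otimes> x" using sc tc xc by (simp add: m_assoc)
      then have "t \<otimes> s = \<one>" using sc tc xc by (metis m_closed one_closed r_cancel)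
      then have "t = s" using inv_equality[of t s] s(1) sc tc by simp
      then show ?thesis using ts by simp
    next
      case (Cons h a')
      then show ?thesis using a that by simp
    qed
    \<comment> \<open>This is the reduced word \<open>b\<close> of \<open>x\<close> with one letter
      deleted, so \<open>p\<close> is shorter than \<open>x\<close>.\<close>
    define e where "e = a' @ d"
    define p where "p = wp e"
    have e: "set e \<subseteq> S" "Suc (length e) = len x" using a(1) a' b unfolding e_def by auto
    have pc: "p \<in> carrier W" using e p_def by simp
    have tsx: "t \<otimes> (s \<otimes> x) = s \<otimes> p" using a(2) a' by (simp add: p_def e_def)
    have sx: "s \<otimes> x = t \<otimes> (s \<otimes> p)" using t(1) sc xc by (simp flip: tsx)
    \<comment> \<open>The word \<open>t # s # e\<close> represents \<open>s \<otimes> x\<close>,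
      which \<open>s\<close> shortens to \<open>x\<close>. A second exchange therefore applies, and
      the cases below record which letter it deletes.\<close>
    have "len (s \<otimes> wp (t # s # e)) \<le> len (wp (t # s # e))"
      using sx lsx s(1) xc by (simp flip: p_def sx)
    moreover have "set (t # s # e) \<subseteq> S" using s(1) t(1) e(1) by simp
    ultimately obtain c q' d' where c: "t # s # e = c @ q' # d'" "s \<otimes> wp (t # s # e) = wp (c @ d')"
      using exchange[OF s(1)] by blast
    have xcd: "x = wp (c @ d')" using c(2) s(1) xc by (simp flip: p_def sx)
    have comm: "s \<otimes> t \<noteq> t \<otimes> s" if "t = r" using neq that by simp
    consider "c = []" | "c = [t]" | c' where "c = t # s # c'"
      using c(1) by (cases c; cases "tl c") auto
    then show False
    proof cases
      case 1
      then have "x = s \<otimes> p" using xcd c(1) by (auto simp: p_def)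
      then have "t \<otimes> (s \<otimes> x) = \<one> \<otimes> x" using tsx xc by simp
      then have "t \<otimes> s \<otimes> x = \<one> \<otimes> x" using sc tc xc by (simp add: m_assoc)
      then have "t \<otimes> s = \<one>" using sc tc xc by (metis m_closed one_closed r_cancel)
      then have "t = s" using inv_equality[of t s] s(1) sc tc by simp
      then show False using ts by simp
    next
      case 2
      \<comment> \<open>Here \<open>t\<close> is a descent of \<open>x\<close>, so
        \<open>t = r\<close>. Comparing two expressions for \<open>s \<otimes> x\<close> shows that
        it commutes with \<open>s\<close>.\<close>
      then have xtp: "x = t \<otimes> p" using xcd c(1) by (auto simp: p_def)
      then have "t \<otimes> x = p" using t(1) pc by simp
      then have "len (t \<otimes> x) < len x" using len_le[OF e(1)] e(2) p_def by simp
      then have "t = r" using only t(1) by (simp add: descents_only_def)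
      moreover have "s \<otimes> t \<otimes> p = t \<otimes> s \<otimes> p" using sx xtp sc tc pc by (simp add: m_assoc)
      then have "s \<otimes> t = t \<otimes> s" using sc tc pc by (metis m_closed r_cancel)
      ultimately show False using comm by simp
    next
      case 3
      \<comment> \<open>Here \<open>x = t \<otimes> (s \<otimes> p')\<close> with \<open>p'\<close>
        shorter by at least 2. So \<open>t\<close> is a descent of \<open>x\<close> and lies in
        \<open>K\<close>, and then \<open>s\<close> is a descent of \<open>t \<otimes> x\<close>,
        which would put \<open>s\<close> into \<open>K\<close>.\<close>
      define p' where "p' = wp (c' @ d')"
      have e': "e = c' @ q' # d'" using 3 c(1) by simp
      then have S': "set (c' @ d') \<subseteq> S" "Suc (length (c' @ d')) = length e" using e(1) by auto
      have p'c: "p' \<in> carrier W" unfolding p'_def using S' by (simp del: wp_append)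
      have "x = t \<otimes> (s \<otimes> p')" using xcd 3 by (simp add: p'_def)
      then have tx: "t \<otimes> x = s \<otimes> p'" using t(1) sc p'c by simp
      have lp': "len p' + 2 \<le> len x" using len_le[OF S'(1)] S'(2) e(2) by (simp add: p'_def)
      then have "len (t \<otimes> x) < len x" using tx len_mult_le[OF sc p'c] s(1) by simp
      then have "t \<in> K" using left_descent_in_parabolic[OF K x t(1)] by simp
      then have "t \<otimes> x \<in> generate W K" using x generate.incl generate_mult by metis
      moreover have "s \<otimes> (t \<otimes> x) = p'" using tx s(1) p'c by simp
      moreover have "len x \<le> 1 + len (t \<otimes> x)"
        using len_mult_le[of t "t \<otimes> x"] t(1) tc xc by simp
      ultimately show False using left_descent_in_parabolic[OF K, of "t \<otimes> x" s] s lp' by simp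
    qed
  qed
qed

lemma descents_only_one: "descents_only s \<one>"
  by (simp add: descents_only_def)

lemma descents_only_gen: "s \<in> S \<Longrightarrow> descents_only s s"
proof -
  assume s: "s \<in> S"
  have "t = s" if t: "t \<in> S" "len (t \<otimes> s) < len s" for t
  proof -
    have "t \<otimes> s = \<one>" using t s len_eq_0[of "t \<otimes> s"] by simp
    then show ?thesis using inv_equality[of t s] s t by simp
  qed
  then show ?thesis by (simp add: descents_only_def)
qed

text \<open>The witness \<open>x\<close> is the product of the vertices of a simple path from \<open>s\<close> to \<open>r\<close>, with \<open>r\<close> omitted.\<close>
lemma descents_only_path:
  assumes "finite M" "M \<subseteq> S" "s \<in> M" "r \<in> component M s"
  shows "\<exists>x \<in> generate W M. descents_only s x \<and> descents_only s (x \<otimes> r)"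
  using assms
proof (induction "card M" arbitrary: M s rule: less_induct)
  case less
  have s: "s \<in> S" using less.prems by auto
  show ?case
  proof (cases "r = s")
    case True
    then show ?thesis
      using s descents_only_one descents_only_gen by (intro bexI[of _ "\<one>"]) (auto intro: generate.one)
  next
    case False
    then obtain t where t: "t \<in> M - {s}" "s \<otimes> t \<noteq> t \<otimes> s" "r \<in> component (M - {s}) t"
      using component_first_step less.prems by blast
    have card: "card (M - {s}) < card M" using less.prems by (meson card_Diff1_less)
    have K: "M - {s} \<subseteq> S" "s \<notin> M - {s}" using less.prems by auto
    obtain x where x: "x \<in> generate W (M - {s})" "descents_only t x" "descents_only t (x \<otimes> r)"
      using less.hyps[OF card, of t] less.prems t by auto
    have r: "r \<in> M - {s}" using component_subset[OF t(1)] t(3) by blast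
    then have xr: "x \<otimes> r \<in> generate W (M - {s})" using x generate.incl generate_mult by metis
    have "descents_only s (s \<otimes> x)" "descents_only s (s \<otimes> (x \<otimes> r))"
      using descents_only_step[OF K(1) s K(2)] x xr t by blast+
    moreover have "s \<otimes> (x \<otimes> r) = s \<otimes> x \<otimes> r"
      using s x K r generate_closed[OF K(1) x(1)] by (simp add: m_assoc subset_iff)
    moreover have "x \<in> generate W M" using x(1) mono_generate[of "M - {s}" M] by blast
    then have "s \<otimes> x \<in> generate W M" using less.prems generate.incl generate_mult by metis
    ultimately show ?thesis by auto
  qed
qed

text \<open>
  If \<open>x\<close> has no left descent in \<open>I\<close>, then the first factor of a length-additive factorization
  \<open>x w = u w v\<close> is trivial, so \<open>w\<^sup>-\<^sup>1 x w\<close> lies in \<open>W\<^sub>J\<close>. Applying this to the two elements \<open>x\<close> and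
  \<open>x r\<close> gives the claim for \<open>r\<close>.
\<close>
lemma component_conjugate_left:
  assumes "finite M" "M \<subseteq> S" "N \<subseteq> S" "I \<subseteq> M" "J \<subseteq> N" "w \<in> carrier W"
    and shortest: "shortest_in w (double_coset W M w N)"
    and eq: "double_coset W I w J = double_coset W M w N"
    and s: "s \<in> M" "s \<notin> I" and r: "r \<in> component M s"
  shows "inv w \<otimes> r \<otimes> w \<in> J"
proof -
  have IJ: "I \<subseteq> S" "J \<subseteq> S" using assms by auto
  have conj: "inv w \<otimes> x \<otimes> w \<in> generate W J" if x: "x \<in> generate W M" "descents_only s x" for x
  proof -
    have xc: "x \<in> carrier W" using x assms(2) by simp
    have "x \<otimes> w \<in> double_coset W I w J" unfolding eq
      using double_coset_mult_left[OF assms(2,3,6)] double_coset_self[OF assms(2,3,6)] x(1) by blast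
    then obtain u v where uv: "u \<in> generate W I" "v \<in> generate W J" "x \<otimes> w = u \<otimes> w \<otimes> v"
        "len (x \<otimes> w) = len u + len w + len v"
      using double_coset_reduced[OF IJ assms(6)] shortest eq by metis
    have uvc: "u \<in> carrier W" "v \<in> carrier W" using uv IJ by auto
    have "u = \<one>"
    proof (rule ccontr)
      assume "u \<noteq> \<one>"
      then obtain i where i: "i \<in> I" "len (i \<otimes> u) < len u"
        using left_descent_exists[OF IJ(1) uv(1)] by metis
      have ic: "i \<in> S" "i \<in> carrier W" "i \<in> M" using i IJ assms(4) by auto
      \<comment> \<open>A descent \<open>i\<close> of \<open>u\<close> shortens
        \<open>x \<otimes> w\<close>, hence also \<open>x\<close> by additivity. So
        \<open>i = s\<close>, which is not in \<open>I\<close>.\<close>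
      have "i \<otimes> x \<in> generate W M" using generate_mult[OF generate.incl x(1)] ic by blast
      then have "len (i \<otimes> x) + len w = len (i \<otimes> x \<otimes> w)"
        using len_mult_shortest_left[OF assms(2,3,6) shortest] by simp
      also have "i \<otimes> x \<otimes> w = i \<otimes> (x \<otimes> w)" using ic xc assms(6) by (simp add: m_assoc)
      also have "\<dots> = i \<otimes> u \<otimes> w \<otimes> v" unfolding uv(3) using ic uvc assms(6) by (simp add: m_assoc)
      also have "len \<dots> \<le> len (i \<otimes> u) + len w + len v"
        using len_mult_le[of "i \<otimes> u" w] len_mult_le[of "i \<otimes> u \<otimes> w" v] ic uvc assms(6) by simp
      also have "\<dots> < len (x \<otimes> w)" using i(2) uv(4) by simp
      also have "\<dots> = len x + len w"
        using len_mult_shortest_left[OF assms(2,3,6) shortest x(1)] .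
      finally have "i = s" using x(2) ic by (simp add: descents_only_def)
      then show False using s i by simp
    qed
    then have "x \<otimes> w = w \<otimes> v" using uv(3) assms(6) by simp
    then have "inv w \<otimes> x \<otimes> w = v" using xc uvc assms(6) by (simp add: m_assoc)
    then show ?thesis using uv(2) by simp
  qed
  obtain x where x: "x \<in> generate W M" "descents_only s x" "descents_only s (x \<otimes> r)"
    using descents_only_path assms by metis
  have rM: "r \<in> M" using component_subset[OF s(1)] r by blast
  have car: "x \<in> carrier W" "r \<in> carrier W" using x rM assms(2) by auto
  have "x \<otimes> r \<in> generate W M" using generate_mult[OF x(1) generate.incl[OF rM]] .
  then have "inv (inv w \<otimes> x \<otimes> w) \<otimes> (inv w \<otimes> (x \<otimes> r) \<otimes> w) \<in> generate W J"
    using generate_mult[OF generate_inv[OF IJ(2)]] conj x by blast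
  moreover have "inv (inv w \<otimes> x \<otimes> w) \<otimes> (inv w \<otimes> (x \<otimes> r) \<otimes> w) = inv w \<otimes> r \<otimes> w"
    using car assms(6) by (simp add: group_simps)
  ultimately have v: "inv w \<otimes> r \<otimes> w \<in> generate W J" by simp
  then have "inv w \<otimes> r \<otimes> w \<in> generate W N" using mono_generate[OF assms(5)] by blast
  \<comment> \<open>The elements \<open>w \<otimes> (inv w \<otimes> r \<otimes> w)\<close> and
    \<open>r \<otimes> w\<close> coincide, and length is additive in both products. Hence the
    conjugate has length 1 and is a generator.\<close>
  then have "len (w \<otimes> (inv w \<otimes> r \<otimes> w)) = len w + len (inv w \<otimes> r \<otimes> w)"
    using len_mult_shortest_right[OF assms(2,3,6) shortest] by blast
  moreover have "w \<otimes> (inv w \<otimes> r \<otimes> w) = r \<otimes> w" using car assms(6) by (simp add: m_assoc)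
  moreover have "len (r \<otimes> w) = len r + len w"
    using len_mult_shortest_left[OF assms(2,3,6) shortest generate.incl[OF rM]] .
  ultimately have "len (inv w \<otimes> r \<otimes> w) = 1" using rM assms(2) by (simp add: subset_iff)
  then have "inv w \<otimes> r \<otimes> w \<in> S" by (rule len_eq_1[rotated]) (use car assms(6) in simp)
  then show ?thesis using gen_in_generate_iff[OF IJ(2)] v by blast
qed

text \<open>Inversion exchanges left and right, so this is the left version for the inverse double
  coset.\<close>

lemma component_conjugate_right:
  assumes "finite N" "M \<subseteq> S" "N \<subseteq> S" "I \<subseteq> M" "J \<subseteq> N" "w \<in> carrier W"
    and shortest: "shortest_in w (double_coset W M w N)"
    and eq: "double_coset W I w J = double_coset W M w N"
    and t: "t \<in> N" "t \<notin> J" and r: "r \<in> component N t"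
  shows "w \<otimes> r \<otimes> inv w \<in> I"
proof -
  have IJ: "I \<subseteq> S" "J \<subseteq> S" using assms by auto
  have "double_coset W J (inv w) I = double_coset W N (inv w) M"
    using double_coset_inv[OF IJ assms(6)] double_coset_inv[OF assms(2,3,6)] eq by simp
  then have "inv (inv w) \<otimes> r \<otimes> inv w \<in> I"
    using component_conjugate_left[OF assms(1,3,2,5,4) _ shortest_in_inv[OF assms(2,3,6) shortest] _ t r] assms(6)
    by simp
  then show ?thesis using assms(6) by simp
qed

section \<open>Presentations of a parabolic double coset\<close>

text \<open>As \<open>s\<close> is an involution, mapping \<open>C\<close> into itself already means
  mapping it onto itself.\<close>

definition left_stabilizer :: "'a set \<Rightarrow> 'a set" where
  "left_stabilizer C = {s \<in> S. \<forall>y \<in> C. s \<otimes> y \<in> C}"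

definition right_stabilizer :: "'a set \<Rightarrow> 'a set" where
  "right_stabilizer C = {s \<in> S. \<forall>y \<in> C. y \<otimes> s \<in> C}"

lemma left_stabilizer_subset: "left_stabilizer C \<subseteq> S"
  by (auto simp: left_stabilizer_def)

lemma right_stabilizer_subset: "right_stabilizer C \<subseteq> S"
  by (auto simp: right_stabilizer_def)

lemma subset_stabilizers:
  assumes "I \<subseteq> S" "J \<subseteq> S" "x \<in> carrier W"
  shows "I \<subseteq> left_stabilizer (double_coset W I x J)" "J \<subseteq> right_stabilizer (double_coset W I x J)"
  unfolding left_stabilizer_def right_stabilizer_def
  using assms(1,2) by (auto intro: double_coset_mult_left[OF assms] double_coset_mult_right[OF assms] generate.incl)

lemma left_stabilizer_mult:
  assumes "C \<subseteq> carrier W" "y \<in> C" "x \<in> generate W (left_stabilizer C)"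
  shows "x \<otimes> y \<in> C"
proof -
  obtain u where u: "set u \<subseteq> left_stabilizer C" "wp u = x"
    using assms generate_iff[OF left_stabilizer_subset] by blast
  from u(1) have "wp u \<otimes> y \<in> C"
  proof (induction u)
    case Nil
    then show ?case using assms by auto
  next
    case (Cons s u)
    have "set u \<subseteq> S" "s \<in> S" using Cons.prems left_stabilizer_subset by auto
    moreover have "s \<otimes> (wp u \<otimes> y) \<in> C" using Cons by (simp add: left_stabilizer_def)
    ultimately show ?case using assms by (simp add: m_assoc subset_iff)
  qed
  then show ?thesis using u by simp
qed

lemma right_stabilizer_mult:
  assumes "C \<subseteq> carrier W" "y \<in> C" "x \<in> generate W (right_stabilizer C)"
  shows "y \<otimes> x \<in> C"
proof -
  obtain u where u: "set u \<subseteq> right_stabilizer C" "wp u = x"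
    using assms generate_iff[OF right_stabilizer_subset] by blast
  from u(1) assms(2) have "y \<otimes> wp u \<in> C"
  proof (induction u arbitrary: y)
    case Nil
    then show ?case using assms(1) by auto
  next
    case (Cons s u)
    have S: "set u \<subseteq> S" "s \<in> S" using Cons.prems right_stabilizer_subset by auto
    have y: "y \<in> carrier W" using Cons.prems assms(1) by auto
    have "y \<otimes> s \<in> C" using Cons.prems by (simp add: right_stabilizer_def)
    then have "(y \<otimes> s) \<otimes> wp u \<in> C" using Cons by simp
    then show ?case using S y by (simp add: m_assoc)
  qed
  then show ?thesis using u by simp
qed

end

lemma (in group) conjugate_coset_iff:
  assumes "A \<subseteq> carrier G" "g \<in> carrier G" "x \<in> carrier G"
  shows "x \<in> (g <#\<^bsub>G\<^esub> A) #> inv g \<longleftrightarrow> inv g \<otimes> x \<otimes> g \<in> A"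
proof
  assume "x \<in> (g <#\<^bsub>G\<^esub> A) #> inv g"
  then obtain a where a: "a \<in> A" "x = g \<otimes> a \<otimes> inv g" by (auto simp: l_coset_def r_coset_def)
  then have "a \<in> carrier G" using assms by auto
  then have "inv g \<otimes> x \<otimes> g = a"
    unfolding a(2) using assms(2) by (metis inv_closed inv_solve_left' inv_solve_right' m_assoc m_closed)
  then show "inv g \<otimes> x \<otimes> g \<in> A" using a(1) by simp
next
  assume *: "inv g \<otimes> x \<otimes> g \<in> A"
  have "x = g \<otimes> (inv g \<otimes> x \<otimes> g) \<otimes> inv g"
    using assms(2,3) by (metis inv_closed inv_solve_left' inv_solve_right' m_assoc m_closed)
  then show "x \<in> (g <#\<^bsub>G\<^esub> A) #> inv g"
    unfolding l_coset_def r_coset_def using * by blast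
qed

section \<open>The largest and the smallest presentation of a fixed double coset\<close>

locale parabolic_coset = coxeter +
  fixes C :: "'a set" and w :: 'a
  assumes finite: "finite S"
    and parabolic: "\<exists>I J. I \<subseteq> S \<and> J \<subseteq> S \<and> C = double_coset W I w J"
    and w_closed: "w \<in> carrier W"
    and shortest: "shortest_in w C"
begin

abbreviation L :: "'a set" where "L \<equiv> left_stabilizer C"
abbreviation R :: "'a set" where "R \<equiv> right_stabilizer C"

lemma L_subset: "L \<subseteq> S" and R_subset: "R \<subseteq> S"
  by (rule left_stabilizer_subset right_stabilizer_subset)+

lemma C_closed: "C \<subseteq> carrier W"
  using parabolic double_coset_closed[OF _ _ w_closed] by blast

lemma w_in: "w \<in> C"
  using shortest by (simp add: shortest_in_def)

lemma finite_stabilizers: "finite L" "finite R"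
  by (rule finite_subset[OF L_subset finite] finite_subset[OF R_subset finite])+

lemma subset_LR:
  assumes "I \<subseteq> S" "J \<subseteq> S" "C = double_coset W I w J"
  shows "I \<subseteq> L" "J \<subseteq> R"
  using subset_stabilizers[OF assms(1,2) w_closed] assms(3) by simp_all

text \<open>This is the largest presentation: stabilizing generators keep \<open>w\<close> inside
  \<open>C\<close>, and every presentation through \<open>w\<close> is contained in this
  one.\<close>

lemma double_coset_stabilizers: "double_coset W L w R = C"
proof
  show "double_coset W L w R \<subseteq> C"
  proof
    fix y assume "y \<in> double_coset W L w R"
    then obtain u v where "u \<in> generate W L" "v \<in> generate W R" "y = u \<otimes> w \<otimes> v"
      using double_coset_iff[OF L_subset R_subset w_closed] by blast
    then show "y \<in> C"
      using left_stabilizer_mult[OF C_closed w_in] right_stabilizer_mult[OF C_closed] by blast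
  qed
  obtain I J where IJ: "I \<subseteq> S" "J \<subseteq> S" "C = double_coset W I w J" using parabolic by blast
  then show "C \<subseteq> double_coset W L w R"
    using double_coset_mono[OF subset_LR[OF IJ] L_subset R_subset w_closed] by blast
qed

definition left_core :: "'a set" where
  "left_core = {s \<in> L. \<exists>r \<in> component L s. inv w \<otimes> r \<otimes> w \<notin> R}"

text \<open>The asymmetry with \<open>left_core\<close> mirrors the lexicographic order: the left
  set is minimized first, and a component of \<open>R\<close> may be dropped only if
  \<open>w\<close> conjugates it into the left set already chosen.\<close>

definition right_core :: "'a set" where
  "right_core = {t \<in> R. \<exists>r \<in> component R t. w \<otimes> r \<otimes> inv w \<notin> left_core}"

lemma core_subset: "left_core \<subseteq> L" "right_core \<subseteq> R" "left_core \<subseteq> S" "right_core \<subseteq> S"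
  using L_subset R_subset by (auto simp: left_core_def right_core_def)

lemma left_core_closed:
  assumes "s \<in> left_core" "m \<in> L" "s \<otimes> m \<noteq> m \<otimes> s"
  shows "m \<in> left_core"
proof -
  have "m \<in> component L s" using assms component_step[OF _ component_refl] core_subset(1) by blast
  then show ?thesis using assms component_eq by (auto simp: left_core_def)
qed

lemma right_core_closed:
  assumes "t \<in> right_core" "m \<in> R" "t \<otimes> m \<noteq> m \<otimes> t"
  shows "m \<in> right_core"
proof -
  have "m \<in> component R t" using assms component_step[OF _ component_refl] core_subset(2) by blast
  then show ?thesis using assms component_eq by (auto simp: right_core_def)
qed

text \<open>The discarded part of the left factor is moved across \<open>w\<close> into the right
  factor. The discarded part of the resulting right factor is then moved back, and it lands in
  \<open>generate W left_core\<close>.\<close>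

lemma double_coset_core: "double_coset W left_core w right_core = C"
proof
  show "double_coset W left_core w right_core \<subseteq> C"
    using double_coset_mono[OF core_subset(1,2) L_subset R_subset w_closed]
      double_coset_stabilizers by simp
  show "C \<subseteq> double_coset W left_core w right_core"
  proof
    fix y assume "y \<in> C"
    then obtain u v where uv: "u \<in> generate W L" "v \<in> generate W R" "y = u \<otimes> w \<otimes> v"
      using double_coset_iff[OF L_subset R_subset w_closed]
        double_coset_stabilizers by blast
    obtain a b where ab: "a \<in> generate W left_core" "b \<in> generate W (L - left_core)" "u = a \<otimes> b"
      using generate_split[OF L_subset core_subset(1) _ uv(1)] left_core_closed by blast
    have "inv w \<otimes> s \<otimes> w \<in> R" if "s \<in> L - left_core" for s
      using that component_refl[of s L] by (auto simp: left_core_def)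
    then have "inv w \<otimes> b \<otimes> inv (inv w) \<in> generate W R"
      using w_closed L_subset
      by (intro generate_conjugate[OF _ _ _ R_subset ab(2)]) (auto simp: generate.incl)
    then have "inv w \<otimes> b \<otimes> w \<otimes> v \<in> generate W R" using w_closed generate_mult uv(2) by simp
    moreover have "p \<otimes> q = q \<otimes> p" if "p \<in> R - right_core" "q \<in> R - (R - right_core)" for p q
      using that right_core_closed[of q p] by (metis DiffD1 DiffD2 DiffI)
    \<comment> \<open>The discarded part is put first, so that \<open>c\<close> stands next to
      \<open>w\<close> and can be carried to the left.\<close>
    ultimately obtain c d where cd: "c \<in> generate W (R - right_core)"
        "d \<in> generate W (R - (R - right_core))" "inv w \<otimes> b \<otimes> w \<otimes> v = c \<otimes> d"
      using generate_split[OF R_subset, of "R - right_core"] by blast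
    have "R - (R - right_core) = right_core" using core_subset(2) by auto
    then have d: "d \<in> generate W right_core" using cd by simp
    have "w \<otimes> t \<otimes> inv w \<in> left_core" if "t \<in> R - right_core" for t
      using that component_refl[of t R] by (auto simp: right_core_def)
    then have c: "w \<otimes> c \<otimes> inv w \<in> generate W left_core"
      using R_subset
      by (intro generate_conjugate[OF _ w_closed _ core_subset(3) cd(1)]) (auto simp: generate.incl)
    have bS: "b \<in> carrier W" "c \<in> carrier W"
      using generate_closed[of "L - left_core" b] generate_closed[of "R - right_core" c] ab cd
        L_subset R_subset by blast+
    have car: "a \<in> carrier W" "d \<in> carrier W" "v \<in> carrier W"
      using ab d uv core_subset(3,4) R_subset by auto
    have "y = a \<otimes> w \<otimes> (inv w \<otimes> b \<otimes> w \<otimes> v)"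
      unfolding uv(3) ab(3) using car bS w_closed by (simp add: m_assoc)
    also have "\<dots> = (a \<otimes> (w \<otimes> c \<otimes> inv w)) \<otimes> w \<otimes> d"
      unfolding cd(3) using car bS w_closed by (simp add: m_assoc)
    finally show "y \<in> double_coset W left_core w right_core"
      using double_coset_iff[OF core_subset(3,4) w_closed] generate_mult[OF ab(1) c] d by blast
  qed
qed

lemma conjugate_left:
  assumes "I \<subseteq> S" "J \<subseteq> S" "C = double_coset W I w J" "s \<in> L" "s \<notin> I" "r \<in> component L s"
  shows "inv w \<otimes> r \<otimes> w \<in> J"
  by (rule component_conjugate_left[OF finite_stabilizers(1) L_subset R_subset
        subset_LR[OF assms(1-3)] w_closed _ _ assms(4-6)])
    (simp_all add: double_coset_stabilizers shortest flip: assms(3))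

lemma conjugate_right:
  assumes "I \<subseteq> S" "J \<subseteq> S" "C = double_coset W I w J" "t \<in> R" "t \<notin> J" "r \<in> component R t"
  shows "w \<otimes> r \<otimes> inv w \<in> I"
  by (rule component_conjugate_right[OF finite_stabilizers(2) L_subset R_subset
        subset_LR[OF assms(1-3)] w_closed _ _ assms(4-6)])
    (simp_all add: double_coset_stabilizers shortest flip: assms(3))

text \<open>If some \<open>s\<close> of \<open>left_core\<close> were missing from \<open>I\<close>,
  rigidity would conjugate its whole component of \<open>L\<close> into \<open>J\<close>, hence into
  \<open>R\<close>, against the choice of \<open>left_core\<close>.\<close>

lemma left_core_least:
  assumes "I \<subseteq> S" "J \<subseteq> S" "C = double_coset W I w J"
  shows "left_core \<subseteq> I"
  using conjugate_left[OF assms] subset_LR[OF assms] by (auto simp: left_core_def)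

lemma right_core_least:
  assumes "J \<subseteq> S" "C = double_coset W left_core w J"
  shows "right_core \<subseteq> J"
  using conjugate_right[OF core_subset(3) assms] by (auto simp: right_core_def)

text \<open>Both cores are least by inclusion, the right one once the left set is
  \<open>left_core\<close>. For finite sets this turns equal cardinality into equality, which yields
  uniqueness.\<close>

lemma lex_minimal_presentation_iff:
  "lex_minimal_presentation W S C p \<longleftrightarrow> p = (left_core, w, right_core)"
proof -
  have fin: "finite A" if "A \<subseteq> S" for A using finite that by (rule finite_subset[rotated])
  have minimum: "bruhat_minimum W S C x \<longleftrightarrow> x = w" for x
  proof -
    have "bruhat_minimum W S C x \<longleftrightarrow> shortest_in x C"
      using bruhat_minimum_iff[OF L_subset R_subset w_closed]
        double_coset_stabilizers by simp
    moreover have "shortest_in x C \<Longrightarrow> x = w"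
      using shortest_in_unique[OF L_subset R_subset w_closed, unfolded double_coset_stabilizers, OF shortest] .
    ultimately show ?thesis using shortest by blast
  qed
  have core: "presentation W S C (left_core, w, right_core)"
    using core_subset w_closed double_coset_core by (simp add: presentation_def)
  \<comment> \<open>A competing presentation may use another representative, but since
    \<open>w\<close> lies in \<open>C\<close> it can be replaced by \<open>w\<close> with the same
    \<open>I\<close> and \<open>J\<close>.\<close>
  have via_w: "I \<subseteq> S \<and> J \<subseteq> S \<and> C = double_coset W I w J" if "presentation W S C (I, x, J)" for I x J
  proof -
    have IxJ: "I \<subseteq> S" "J \<subseteq> S" "x \<in> carrier W" "C = double_coset W I x J"
      using that by (auto simp: presentation_def)
    then show ?thesis using double_coset_eq[OF IxJ(1-3)] w_in by blast
  qed
  show ?thesis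
  proof
    assume lex: "lex_minimal_presentation W S C p"
    obtain I x J where p: "p = (I, x, J)" by (cases p)
    have "presentation W S C (I, x, J)" and x: "x = w"
      and le: "card I < card left_core \<or> card I = card left_core \<and> card J \<le> card right_core"
      using lex minimum core unfolding p lex_minimal_presentation_def by blast+
    then have IJ: "I \<subseteq> S" "J \<subseteq> S" "C = double_coset W I w J" using via_w by blast+
    have "card left_core \<le> card I" using card_mono[OF fin[OF IJ(1)] left_core_least[OF IJ]] .
    then have "card left_core = card I" and J: "card J \<le> card right_core" using le by auto
    then have I: "left_core = I" using card_subset_eq[OF fin[OF IJ(1)] left_core_least[OF IJ]] by blast
    then have "right_core \<subseteq> J" using right_core_least[OF IJ(2)] IJ(3) by simp
    then have "right_core = J" using card_seteq[OF fin[OF IJ(2)]] J by blast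
    then show "p = (left_core, w, right_core)" using p I x by simp
  next
    assume p: "p = (left_core, w, right_core)"
    have "card left_core < card I \<or> card left_core = card I \<and> card right_core \<le> card J"
      if "presentation W S C (I, x, J)" for I x J
    proof -
      have IJ: "I \<subseteq> S" "J \<subseteq> S" "C = double_coset W I w J" using via_w that by blast+
      show ?thesis
      proof (cases "left_core = I")
        case True
        then show ?thesis using card_mono[OF fin[OF IJ(2)] right_core_least[OF IJ(2)]] IJ(3) by simp
      next
        case False
        then show ?thesis using psubset_card_mono[OF fin[OF IJ(1)]] left_core_least[OF IJ] by blast
      qed
    qed
    then show "lex_minimal_presentation W S C p"
      unfolding p lex_minimal_presentation_def using core minimum by blast
  qed
qed

text \<open>The conclusions are (a) and (b), spelled out on elements. The cores are unions of
  components of \<open>L\<close> and \<open>R\<close>, so their own components are components of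
  \<open>L\<close> and \<open>R\<close>.\<close>

lemma core_imp_conditions:
  assumes I: "I = left_core" and J: "J = right_core"
  shows "\<forall>j \<in> J. \<exists>r \<in> component J j. w \<otimes> r \<otimes> inv w \<notin> I"
    and "\<forall>i \<in> I. (\<forall>r \<in> component I i. inv w \<otimes> r \<otimes> w \<in> S) \<longrightarrow>
      (\<exists>r \<in> component I i. inv w \<otimes> r \<otimes> w \<notin> J) \<and>
      (\<exists>j \<in> J. \<exists>r \<in> component I i. j = inv w \<otimes> r \<otimes> w \<or>
         j \<otimes> (inv w \<otimes> r \<otimes> w) \<noteq> (inv w \<otimes> r \<otimes> w) \<otimes> j)"
proof -
  have compJ: "component J j = component R j" if "j \<in> J" for j
    using component_closed[OF core_subset(2), of j] right_core_closed that J by blast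
  have compI: "component I i = component L i" if "i \<in> I" for i
    using component_closed[OF core_subset(1), of i] left_core_closed that I by blast
  show "\<forall>j \<in> J. \<exists>r \<in> component J j. w \<otimes> r \<otimes> inv w \<notin> I"
    using compJ by (auto simp: I J right_core_def)
  show "\<forall>i \<in> I. (\<forall>r \<in> component I i. inv w \<otimes> r \<otimes> w \<in> S) \<longrightarrow>
      (\<exists>r \<in> component I i. inv w \<otimes> r \<otimes> w \<notin> J) \<and>
      (\<exists>j \<in> J. \<exists>r \<in> component I i. j = inv w \<otimes> r \<otimes> w \<or>
         j \<otimes> (inv w \<otimes> r \<otimes> w) \<noteq> (inv w \<otimes> r \<otimes> w) \<otimes> j)"
  proof (intro ballI impI)
    fix i assume i: "i \<in> I" and simple: "\<forall>r \<in> component I i. inv w \<otimes> r \<otimes> w \<in> S"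
    obtain r where r: "r \<in> component I i" "inv w \<otimes> r \<otimes> w \<notin> R"
      using i compI[OF i] by (auto simp: I left_core_def)
    then have "\<exists>r \<in> component I i. inv w \<otimes> r \<otimes> w \<notin> J" using J core_subset(2) by blast
    \<comment> \<open>If \<open>inv w \<otimes> r \<otimes> w\<close> commuted with all of
      \<open>J\<close>, it would be a generator stabilizing \<open>C\<close> from the right,
      although it was chosen outside \<open>R\<close>.\<close>
    moreover have "\<exists>j \<in> J. j \<otimes> (inv w \<otimes> r \<otimes> w) \<noteq> (inv w \<otimes> r \<otimes> w) \<otimes> j"
    proof (rule ccontr)
      assume "\<not> ?thesis"
      then have comm: "j \<in> J \<Longrightarrow> (inv w \<otimes> r \<otimes> w) \<otimes> j = j \<otimes> (inv w \<otimes> r \<otimes> w)" for j by metis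
      let ?k = "inv w \<otimes> r \<otimes> w"
      have IJ: "I \<subseteq> S" "J \<subseteq> S" using I J core_subset by auto
      have C: "C = double_coset W I w J" using I J double_coset_core by simp
      have rI: "r \<in> I" using r(1) component_subset[OF i] by blast
      then have rc: "r \<in> carrier W" using IJ by auto
      have "y \<otimes> ?k \<in> C" if y: "y \<in> C" for y
      proof -
        obtain u v where uv: "u \<in> generate W I" "v \<in> generate W J" "y = u \<otimes> w \<otimes> v"
          using y C double_coset_iff[OF IJ w_closed] by blast
        have car: "u \<in> carrier W" "v \<in> carrier W" using uv IJ by auto
        \<comment> \<open>Commuting past \<open>v\<close> brings \<open>?k\<close> next to
          \<open>w\<close>, where \<open>w \<otimes> ?k = r \<otimes> w\<close>; the factor
          \<open>r\<close> is then absorbed by \<open>u\<close>.\<close>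
        have "?k \<otimes> v = v \<otimes> ?k"
          using generate_commute[OF IJ(2) _ comm uv(2)] rc w_closed by simp
        then have "y \<otimes> ?k = u \<otimes> w \<otimes> (?k \<otimes> v)"
          unfolding uv(3) using car rc w_closed by (simp only: m_assoc m_closed inv_closed)
        also have "\<dots> = (u \<otimes> r) \<otimes> w \<otimes> v" using car rc w_closed by (simp add: m_assoc)
        finally show ?thesis
          unfolding C using double_coset_iff[OF IJ w_closed] uv(2)
            generate_mult[OF uv(1) generate.incl[OF rI]] by blast
      qed
      then show False using r simple by (simp add: right_stabilizer_def)
    qed
    ultimately show "(\<exists>r \<in> component I i. inv w \<otimes> r \<otimes> w \<notin> J) \<and>
      (\<exists>j \<in> J. \<exists>r \<in> component I i. j = inv w \<otimes> r \<otimes> w \<or>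
         j \<otimes> (inv w \<otimes> r \<otimes> w) \<noteq> (inv w \<otimes> r \<otimes> w) \<otimes> j)" using r(1) by blast
  qed
qed

text \<open>If some \<open>i\<close> of \<open>I\<close> were outside \<open>left_core\<close>, its
  component would be conjugated into one component of \<open>R\<close>. By (b) this component of
  \<open>R\<close> contains an element of \<open>J\<close> and an element outside \<open>J\<close>.
  Rigidity then conjugates all of it into \<open>I\<close>, which contradicts (a).\<close>

lemma conditions_imp_core:
  assumes IJ: "I \<subseteq> S" "J \<subseteq> S" and C: "C = double_coset W I w J"
    and a: "\<forall>j \<in> J. \<exists>r \<in> component J j. w \<otimes> r \<otimes> inv w \<notin> I"
    and b: "\<forall>i \<in> I. (\<forall>r \<in> component I i. inv w \<otimes> r \<otimes> w \<in> S) \<longrightarrow>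
      (\<exists>r \<in> component I i. inv w \<otimes> r \<otimes> w \<notin> J) \<and>
      (\<exists>j \<in> J. \<exists>r \<in> component I i. j = inv w \<otimes> r \<otimes> w \<or>
         j \<otimes> (inv w \<otimes> r \<otimes> w) \<noteq> (inv w \<otimes> r \<otimes> w) \<otimes> j)"
  shows "I = left_core \<and> J = right_core"
proof -
  note sub = subset_LR[OF IJ C]
  have "i \<in> left_core" if i: "i \<in> I" for i
  proof (rule ccontr)
    assume "i \<notin> left_core"
    then have inR: "\<And>r. r \<in> component L i \<Longrightarrow> inv w \<otimes> r \<otimes> w \<in> R"
      using i sub by (auto simp: left_core_def)
    have compI: "component I i \<subseteq> component L i" using component_mono sub by blast
    let ?k = "inv w \<otimes> i \<otimes> w"
    have "\<forall>r \<in> component I i. inv w \<otimes> r \<otimes> w \<in> S" using inR compI R_subset by blast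
    then obtain r0 j r1 where r0: "r0 \<in> component I i" "inv w \<otimes> r0 \<otimes> w \<notin> J"
      and j: "j \<in> J" and r1: "r1 \<in> component I i" "j = inv w \<otimes> r1 \<otimes> w \<or>
         j \<otimes> (inv w \<otimes> r1 \<otimes> w) \<noteq> (inv w \<otimes> r1 \<otimes> w) \<otimes> j"
      using b i by meson
    have Lc: "L \<subseteq> carrier W" using L_subset by auto
    have conj: "inv w \<otimes> r \<otimes> w \<in> component R ?k" if "r \<in> component I i" for r
      using component_conjugate[OF Lc, of "inv w" i R r] inR that compI w_closed i sub by auto
    have kR: "?k \<in> R" using inR component_refl by blast
    \<comment> \<open>Whether \<open>j\<close> equals the conjugate of \<open>r1\<close> or is
      adjacent to it, both lie in the same component of \<open>R\<close>.\<close>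
    have "j \<in> component R ?k"
      using r1(2) conj[OF r1(1)] component_step[OF kR conj[OF r1(1)], of j] j sub(2) by force
    then have "component R j = component R ?k" by (rule component_eq)
    moreover have "component R (inv w \<otimes> r0 \<otimes> w) = component R ?k" using conj[OF r0(1)] by (rule component_eq)
    \<comment> \<open>Rigidity applies at the conjugate of \<open>r0\<close>, which is in
      \<open>R\<close> but not in \<open>J\<close>; \<open>j\<close> shares its component.\<close>
    ultimately have "w \<otimes> r \<otimes> inv w \<in> I" if "r \<in> component R j" for r
      using conjugate_right[OF IJ C _ r0(2)] inR r0(1) compI that by blast
    moreover have "component J j \<subseteq> component R j" using component_mono sub by blast
    ultimately show False using a j by blast
  qed
  then have I: "I = left_core" using left_core_least[OF IJ C] by blast
  moreover have "J \<subseteq> right_core"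
  proof
    fix j assume j: "j \<in> J"
    then obtain r where "r \<in> component J j" "w \<otimes> r \<otimes> inv w \<notin> left_core" using a I by blast
    moreover have "component J j \<subseteq> component R j" using component_mono sub by blast
    ultimately show "j \<in> right_core" using j sub by (auto simp: right_core_def)
  qed
  moreover have "right_core \<subseteq> J" using right_core_least[OF IJ(2) C[unfolded I]] .
  ultimately show ?thesis by blast
qed

lemma lex_minimal_presentation_conditions:
  assumes IJ: "I \<subseteq> S" "J \<subseteq> S" and C: "C = double_coset W I w J"
  shows "lex_minimal_presentation W S C (I, w, J) \<longleftrightarrow>
    (\<forall>J0 \<in> coxeter_components W J. \<not> J0 \<subseteq> ((inv w <#\<^bsub>W\<^esub> I) #> w) \<inter> S) \<and>
    (\<forall>I0 \<in> coxeter_components W I. I0 \<subseteq> (w <#\<^bsub>W\<^esub> S) #> inv w \<longrightarrow> \<not> (inv w <#\<^bsub>W\<^esub> I0) #> w \<subseteq> J \<and>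
       (\<exists>j \<in> J. j \<in> (inv w <#\<^bsub>W\<^esub> I0) #> w \<or> (\<exists>k \<in> (inv w <#\<^bsub>W\<^esub> I0) #> w. coxeter_adj W j k)))"
proof -
  have car: "I \<subseteq> carrier W" "J \<subseteq> carrier W" "S \<subseteq> carrier W" using IJ by auto
  have compI: "component I i \<subseteq> I" if "i \<in> I" for i using component_subset that by blast
  have compJ: "component J j \<subseteq> J" if "j \<in> J" for j using component_subset that by blast
  have a: "(\<forall>J0 \<in> coxeter_components W J. \<not> J0 \<subseteq> ((inv w <#\<^bsub>W\<^esub> I) #> w) \<inter> S) \<longleftrightarrow>
      (\<forall>j \<in> J. \<exists>r \<in> component J j. w \<otimes> r \<otimes> inv w \<notin> I)"
  proof -
    have "r \<in> ((inv w <#\<^bsub>W\<^esub> I) #> w) \<inter> S \<longleftrightarrow> w \<otimes> r \<otimes> inv w \<in> I" if "r \<in> J" for r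
      using conjugate_coset_iff[OF car(1), of "inv w" r] w_closed that IJ car by auto
    then have "component J j \<subseteq> ((inv w <#\<^bsub>W\<^esub> I) #> w) \<inter> S \<longleftrightarrow> (\<forall>r \<in> component J j. w \<otimes> r \<otimes> inv w \<in> I)"
      if "j \<in> J" for j using compJ[OF that] by blast
    then show ?thesis unfolding coxeter_components_eq[OF IJ(2)] by (simp only: ball_simps cong: ball_cong)
  qed
  have b: "(I0 \<subseteq> (w <#\<^bsub>W\<^esub> S) #> inv w \<longrightarrow> \<not> (inv w <#\<^bsub>W\<^esub> I0) #> w \<subseteq> J \<and>
         (\<exists>j \<in> J. j \<in> (inv w <#\<^bsub>W\<^esub> I0) #> w \<or> (\<exists>k \<in> (inv w <#\<^bsub>W\<^esub> I0) #> w. coxeter_adj W j k))) \<longleftrightarrow>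
      ((\<forall>r \<in> I0. inv w \<otimes> r \<otimes> w \<in> S) \<longrightarrow> (\<exists>r \<in> I0. inv w \<otimes> r \<otimes> w \<notin> J) \<and>
         (\<exists>j \<in> J. \<exists>r \<in> I0. j = inv w \<otimes> r \<otimes> w \<or>
            j \<otimes> (inv w \<otimes> r \<otimes> w) \<noteq> (inv w \<otimes> r \<otimes> w) \<otimes> j))" if I0: "I0 \<subseteq> I" for I0
  proof -
    have 1: "I0 \<subseteq> (w <#\<^bsub>W\<^esub> S) #> inv w \<longleftrightarrow> (\<forall>r \<in> I0. inv w \<otimes> r \<otimes> w \<in> S)"
      using conjugate_coset_iff[OF car(3) w_closed] I0 car(1) by blast
    have 2: "(inv w <#\<^bsub>W\<^esub> I0) #> w = (\<lambda>r. inv w \<otimes> r \<otimes> w) ` I0"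
      by (auto simp: l_coset_def r_coset_def)
    \<comment> \<open>Adjacency means noncommutation only between generators; the premise of (b)
      guarantees that the conjugates are generators.\<close>
    have 3: "coxeter_adj W j (inv w \<otimes> r \<otimes> w) \<longleftrightarrow>
        j \<otimes> (inv w \<otimes> r \<otimes> w) \<noteq> (inv w \<otimes> r \<otimes> w) \<otimes> j"
      if "j \<in> J" "r \<in> I0" "\<forall>r \<in> I0. inv w \<otimes> r \<otimes> w \<in> S" for j r
      using coxeter_adj_iff[of j "inv w \<otimes> r \<otimes> w"] that IJ(2) by blast
    show ?thesis unfolding 1 2 using 3 by (auto simp del: cancel_simps)
  qed
  have "lex_minimal_presentation W S C (I, w, J) \<longleftrightarrow>
      I = left_core \<and> J = right_core"
    unfolding lex_minimal_presentation_iff by simp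
  also have "\<dots> \<longleftrightarrow> (\<forall>j \<in> J. \<exists>r \<in> component J j. w \<otimes> r \<otimes> inv w \<notin> I) \<and>
      (\<forall>i \<in> I. (\<forall>r \<in> component I i. inv w \<otimes> r \<otimes> w \<in> S) \<longrightarrow>
        (\<exists>r \<in> component I i. inv w \<otimes> r \<otimes> w \<notin> J) \<and>
        (\<exists>j \<in> J. \<exists>r \<in> component I i. j = inv w \<otimes> r \<otimes> w \<or>
           j \<otimes> (inv w \<otimes> r \<otimes> w) \<noteq> (inv w \<otimes> r \<otimes> w) \<otimes> j))"
    using core_imp_conditions[of I J] conditions_imp_core[OF IJ C] by blast
  also have "\<dots> \<longleftrightarrow> (\<forall>J0 \<in> coxeter_components W J. \<not> J0 \<subseteq> ((inv w <#\<^bsub>W\<^esub> I) #> w) \<inter> S) \<and>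
      (\<forall>I0 \<in> coxeter_components W I. I0 \<subseteq> (w <#\<^bsub>W\<^esub> S) #> inv w \<longrightarrow> \<not> (inv w <#\<^bsub>W\<^esub> I0) #> w \<subseteq> J \<and>
         (\<exists>j \<in> J. j \<in> (inv w <#\<^bsub>W\<^esub> I0) #> w \<or> (\<exists>k \<in> (inv w <#\<^bsub>W\<^esub> I0) #> w. coxeter_adj W j k)))"
    unfolding a using b[OF compI] coxeter_components_eq[OF IJ(1)] by simp
  finally show ?thesis .
qed

end

theorem theorem4p9:
  fixes W :: "('a, 'b) monoid_scheme" and S :: "'a set"
  assumes "coxeter_system W S" and "finite S"
  shows "(\<forall>I J w. I \<subseteq> S \<longrightarrow> J \<subseteq> S \<longrightarrow> w \<in> min_double_reps W S I J \<longrightarrow>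
            (lex_minimal_presentation W S (double_coset W I w J) (I, w, J) \<longleftrightarrow>
               (\<forall>J0 \<in> coxeter_components W J.
                  \<not> J0 \<subseteq> ((inv\<^bsub>W\<^esub> w <#\<^bsub>W\<^esub> I) #>\<^bsub>W\<^esub> w) \<inter> S) \<and>
               (\<forall>I0 \<in> coxeter_components W I.
                  I0 \<subseteq> (w <#\<^bsub>W\<^esub> S) #>\<^bsub>W\<^esub> inv\<^bsub>W\<^esub> w \<longrightarrow>
                  \<not> (inv\<^bsub>W\<^esub> w <#\<^bsub>W\<^esub> I0) #>\<^bsub>W\<^esub> w \<subseteq> J \<and>
                  (\<exists>j \<in> J. j \<in> (inv\<^bsub>W\<^esub> w <#\<^bsub>W\<^esub> I0) #>\<^bsub>W\<^esub> w \<or>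
                     (\<exists>k \<in> (inv\<^bsub>W\<^esub> w <#\<^bsub>W\<^esub> I0) #>\<^bsub>W\<^esub> w. coxeter_adj W j k)))))
       \<and> (\<forall>C. parabolic_double_coset W S C \<longrightarrow>
            (\<exists>!p. lex_minimal_presentation W S C p))"
proof -
  interpret group W using assms(1) by (simp add: coxeter_system_def)
  interpret coxeter W S by standard (rule assms(1))
  show ?thesis
  proof (rule conjI, intro allI impI, goal_cases)
    case (1 I J w)
    then have w: "w \<in> carrier W" "shortest_in w (double_coset W I w J)"
      using min_double_reps_iff by blast+
    interpret parabolic_coset W S "double_coset W I w J" w
      by standard (use assms(2) 1 w in auto)
    show ?case by (rule lex_minimal_presentation_conditions[OF 1(1,2) refl])
  next
    case 2
    show ?case
    proof (intro allI impI)
      fix C assume "parabolic_double_coset W S C"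
      then obtain I x J where IJ: "I \<subseteq> S" "J \<subseteq> S" "x \<in> carrier W" and C: "C = double_coset W I x J"
        by (auto simp: parabolic_double_coset_def presentation_def)
      \<comment> \<open>The given representative is exchanged for a shortest element of
        \<open>C\<close>, as \<open>parabolic_coset\<close> requires.\<close>
      then obtain w where w: "shortest_in w C"
        using shortest_in_exists double_coset_self[OF IJ] by blast
      then have "w \<in> C" by (simp add: shortest_in_def)
      then have w': "w \<in> carrier W" "C = double_coset W I w J"
        using double_coset_closed[OF IJ] double_coset_eq[OF IJ] C by blast+
      interpret parabolic_coset W S C w
        by standard (use assms(2) IJ w w' in auto)
      show "\<exists>!p. lex_minimal_presentation W S C p"
        unfolding lex_minimal_presentation_iff by simp
    qed
  qed
qed

end
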